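(* For a category $\mathbb{C}$, consider the following axioms. (A1) $\mathbb{C}$ is pointed and has finite products, finite coproducts, equalizers and coequalizers. (A2) For any split epimorphism $p : X \to Y$ with section $s : Y \to X$ (so $ps = 1_Y$) and with kernel $k : K[p] \hookrightarrow X$, the arrow $\langle k, s\rangle : K[p] \amalg Y \to X$ (the unique arrow restricting to $k$ and $s$ on the two summands) is a cokernel. (A3) The pullback of a cokernel (along any morphism) is a cokernel. (A4) The image of a kernel by a cokernel is a kernel. Then: (i) $\mathbb{C}$ is finitely cocomplete and homological if and only if it satisfies (A1), (A2) and (A3). (ii) $\mathbb{C}$ is semi-abelian if and only if it satisfies (A1), (A2), (A3) and (A4). Moreover, in (A1) not all finite colimits are needed: (i) and (ii) remain true when (A1) is replaced by the condition (A1') $\mathbb{C}$ is pointed and has finite products, finite coproducts, all equalizers, and coequalizers of (internal) equivalence relations.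
   Context: A category is pointed if it has a zero object $0$ (both initial and terminal); the zero arrow $0 : X \to Y$ is the one factoring through $0$. The kernel of a morphism is the equalizer of it and the zero arrow; its cokernel is the coequalizer of it and the zero arrow. "Kernel" and "cokernel" denote the corresponding arrows: an arrow "is a kernel" (resp. "is a cokernel") if it is the kernel (resp. cokernel) of some morphism. A regular epimorphism is a morphism which is a coequalizer of some parallel pair. The kernel pair of $f$ is the pair of projections of the pullback of $f$ along itself. A category is regular if it is finitely complete, pullbacks of regular epimorphisms along arbitrary morphisms are regular epimorphisms, and kernel pairs have coequalizers. In a regular category every morphism $f$ factors, uniquely up to isomorphism, as a regular epimorphism followed by a monomorphism; this monomorphism is the image of $f$. The image of a kernel $k : K \to X$ by a cokernel $q : X \to Y$ is the image of the composite $qk$. (Axiom (A4) is considered only in the presence of the preceding axioms (A1) or (A1'), (A2), (A3), under which $\mathbb{C}$ is regular, so that images make sense.) A regular category is exact if every internal equivalence relation in it is the kernel pair of some morphism. A pointed category is protomodular if it has pullbacks of split epimorphisms along any morphism and the split short five lemma holds: given split epimorphisms $q : Z \to W$ with section $r$ ($qr = 1_W$) and kernel $i : K[q] \to Z$, and $p : X \to Y$ with section $s$ ($ps = 1_Y$) and kernel $k : K[p] \to X$, and morphisms $l : K[q] \to K[p]$, $m : Z \to X$, $n : W \to Y$ with $mi = kl$, $nq = pm$, $mr = sn$, if $l$ and $n$ are isomorphisms then so is $m$. A category is homological if it is pointed, regular and protomodular. A category is semi-abelian if it is pointed, exact and protomodular and has finite sums (finite coproducts). Finitely cocomplete means having all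 finite colimits. *)

theory Defs
  imports Main
begin

section \<open>Categories\<close>

text \<open>
  \<open>Comp C g f\<close>, written \<open>g \<cdot>\<^bsub>C\<^esub> f\<close>, is the composite ``\<open>g\<close> after \<open>f\<close>''.  Its values, and those
  of the other operations, are only meaningful on composable arrows and on the carriers
  \<open>Ob C\<close> and \<open>Ar C\<close>.
\<close>

record ('o, 'a) precat =
  Ob :: "'o set"
  Ar :: "'a set"
  Dom :: "'a \<Rightarrow> 'o"
  Cod :: "'a \<Rightarrow> 'o"
  Id :: "'o \<Rightarrow> 'a"
  Comp :: "'a \<Rightarrow> 'a \<Rightarrow> 'a" (infixr "\<cdot>\<index>" 70)

definition hom :: "('o, 'a) precat \<Rightarrow> 'o \<Rightarrow> 'o \<Rightarrow> 'a set" where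
  "hom C X Y = {f \<in> Ar C. Dom C f = X \<and> Cod C f = Y}"

locale category =
  fixes C :: "('o, 'a) precat" (structure)
  assumes dom_in_Ob: "f \<in> Ar C \<Longrightarrow> Dom C f \<in> Ob C"
    and cod_in_Ob: "f \<in> Ar C \<Longrightarrow> Cod C f \<in> Ob C"
    and id_in_hom: "X \<in> Ob C \<Longrightarrow> Id C X \<in> hom C X X"
    and comp_in_hom: "\<lbrakk>f \<in> hom C X Y; g \<in> hom C Y Z\<rbrakk> \<Longrightarrow> g \<cdot> f \<in> hom C X Z"
    and comp_id: "f \<in> hom C X Y \<Longrightarrow> f \<cdot> Id C X = f"
    and id_comp: "f \<in> hom C X Y \<Longrightarrow> Id C Y \<cdot> f = f"
    and comp_assoc:
      "\<lbrakk>f \<in> hom C W X; g \<in> hom C X Y; h \<in> hom C Y Z\<rbrakk> \<Longrightarrow> (h \<cdot> g) \<cdot> f = h \<cdot> (g \<cdot> f)"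

text \<open>A functor is given by its object part \<open>Fo\<close> and its arrow part \<open>Fa\<close>.\<close>

definition is_functor ::
  "('i, 'u) precat \<Rightarrow> ('o, 'a) precat \<Rightarrow> ('i \<Rightarrow> 'o) \<Rightarrow> ('u \<Rightarrow> 'a) \<Rightarrow> bool" where
  "is_functor J C Fo Fa \<longleftrightarrow>
     (\<forall>j\<in>Ob J. Fo j \<in> Ob C) \<and>
     (\<forall>u\<in>Ar J. Fa u \<in> hom C (Fo (Dom J u)) (Fo (Cod J u))) \<and>
     (\<forall>j\<in>Ob J. Fa (Id J j) = Id C (Fo j)) \<and>
     (\<forall>u\<in>Ar J. \<forall>v\<in>Ar J. Cod J u = Dom J v \<longrightarrow> Fa (v \<cdot>\<^bsub>J\<^esub> u) = Fa v \<cdot>\<^bsub>C\<^esub> Fa u)"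

context
  fixes C :: "('o, 'a) precat" (structure)
begin

section \<open>Limits and colimits\<close>

definition is_cone ::
  "('i, 'u) precat \<Rightarrow> ('i \<Rightarrow> 'o) \<Rightarrow> ('u \<Rightarrow> 'a) \<Rightarrow> 'o \<Rightarrow> ('i \<Rightarrow> 'a) \<Rightarrow> bool" where
  "is_cone J Fo Fa L \<pi> \<longleftrightarrow>
     L \<in> Ob C \<and> (\<forall>j\<in>Ob J. \<pi> j \<in> hom C L (Fo j)) \<and>
     (\<forall>u\<in>Ar J. Fa u \<cdot> \<pi> (Dom J u) = \<pi> (Cod J u))"

definition is_limit ::
  "('i, 'u) precat \<Rightarrow> ('i \<Rightarrow> 'o) \<Rightarrow> ('u \<Rightarrow> 'a) \<Rightarrow> 'o \<Rightarrow> ('i \<Rightarrow> 'a) \<Rightarrow> bool" where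
  "is_limit J Fo Fa L \<pi> \<longleftrightarrow>
     is_cone J Fo Fa L \<pi> \<and>
     (\<forall>T \<tau>. is_cone J Fo Fa T \<tau> \<longrightarrow>
        (\<exists>!h. h \<in> hom C T L \<and> (\<forall>j\<in>Ob J. \<pi> j \<cdot> h = \<tau> j)))"

definition is_cocone ::
  "('i, 'u) precat \<Rightarrow> ('i \<Rightarrow> 'o) \<Rightarrow> ('u \<Rightarrow> 'a) \<Rightarrow> 'o \<Rightarrow> ('i \<Rightarrow> 'a) \<Rightarrow> bool" where
  "is_cocone J Fo Fa L \<iota> \<longleftrightarrow>
     L \<in> Ob C \<and> (\<forall>j\<in>Ob J. \<iota> j \<in> hom C (Fo j) L) \<and>
     (\<forall>u\<in>Ar J. \<iota> (Cod J u) \<cdot> Fa u = \<iota> (Dom J u))"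

definition is_colimit ::
  "('i, 'u) precat \<Rightarrow> ('i \<Rightarrow> 'o) \<Rightarrow> ('u \<Rightarrow> 'a) \<Rightarrow> 'o \<Rightarrow> ('i \<Rightarrow> 'a) \<Rightarrow> bool" where
  "is_colimit J Fo Fa L \<iota> \<longleftrightarrow>
     is_cocone J Fo Fa L \<iota> \<and>
     (\<forall>T \<tau>. is_cocone J Fo Fa T \<tau> \<longrightarrow>
        (\<exists>!h. h \<in> hom C L T \<and> (\<forall>j\<in>Ob J. h \<cdot> \<iota> j = \<tau> j)))"

text \<open>
  Every finite category is isomorphic to one whose objects and arrows are natural numbers, so
  quantifying over index categories of type \<open>(nat, nat) precat\<close> covers all finite diagrams.
\<close>

definition finitely_complete :: bool where
  "finitely_complete \<longleftrightarrow>
     (\<forall>(J :: (nat, nat) precat) Fo Fa.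
        category J \<and> finite (Ob J) \<and> finite (Ar J) \<and> is_functor J C Fo Fa \<longrightarrow>
        (\<exists>L \<pi>. is_limit J Fo Fa L \<pi>))"

definition finitely_cocomplete :: bool where
  "finitely_cocomplete \<longleftrightarrow>
     (\<forall>(J :: (nat, nat) precat) Fo Fa.
        category J \<and> finite (Ob J) \<and> finite (Ar J) \<and> is_functor J C Fo Fa \<longrightarrow>
        (\<exists>L \<iota>. is_colimit J Fo Fa L \<iota>))"

definition is_product :: "'i set \<Rightarrow> ('i \<Rightarrow> 'o) \<Rightarrow> 'o \<Rightarrow> ('i \<Rightarrow> 'a) \<Rightarrow> bool" where
  "is_product I X P \<pi> \<longleftrightarrow>
     P \<in> Ob C \<and> (\<forall>i\<in>I. \<pi> i \<in> hom C P (X i)) \<and>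
     (\<forall>T\<in>Ob C. \<forall>\<tau>. (\<forall>i\<in>I. \<tau> i \<in> hom C T (X i)) \<longrightarrow>
        (\<exists>!h. h \<in> hom C T P \<and> (\<forall>i\<in>I. \<pi> i \<cdot> h = \<tau> i)))"

definition is_coproduct :: "'i set \<Rightarrow> ('i \<Rightarrow> 'o) \<Rightarrow> 'o \<Rightarrow> ('i \<Rightarrow> 'a) \<Rightarrow> bool" where
  "is_coproduct I X S \<iota> \<longleftrightarrow>
     S \<in> Ob C \<and> (\<forall>i\<in>I. \<iota> i \<in> hom C (X i) S) \<and>
     (\<forall>T\<in>Ob C. \<forall>\<tau>. (\<forall>i\<in>I. \<tau> i \<in> hom C (X i) T) \<longrightarrow>
        (\<exists>!h. h \<in> hom C S T \<and> (\<forall>i\<in>I. h \<cdot> \<iota> i = \<tau> i)))"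

definition has_finite_products :: bool where
  "has_finite_products \<longleftrightarrow>
     (\<forall>(I :: nat set) X. finite I \<and> (\<forall>i\<in>I. X i \<in> Ob C) \<longrightarrow> (\<exists>P \<pi>. is_product I X P \<pi>))"

definition has_finite_coproducts :: bool where
  "has_finite_coproducts \<longleftrightarrow>
     (\<forall>(I :: nat set) X. finite I \<and> (\<forall>i\<in>I. X i \<in> Ob C) \<longrightarrow> (\<exists>S \<iota>. is_coproduct I X S \<iota>))"

text \<open>\<open>S\<close> is a coproduct of \<open>X\<close> and \<open>Y\<close> with coproduct injections \<open>\<iota>\<^sub>1\<close> and \<open>\<iota>\<^sub>2\<close>.\<close>

definition is_binary_coproduct :: "'o \<Rightarrow> 'o \<Rightarrow> 'o \<Rightarrow> 'a \<Rightarrow> 'a \<Rightarrow> bool" where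
  "is_binary_coproduct X Y S \<iota>\<^sub>1 \<iota>\<^sub>2 \<longleftrightarrow>
     \<iota>\<^sub>1 \<in> hom C X S \<and> \<iota>\<^sub>2 \<in> hom C Y S \<and>
     (\<forall>T f g. f \<in> hom C X T \<and> g \<in> hom C Y T \<longrightarrow>
        (\<exists>!h. h \<in> hom C S T \<and> h \<cdot> \<iota>\<^sub>1 = f \<and> h \<cdot> \<iota>\<^sub>2 = g))"

definition is_equalizer :: "'a \<Rightarrow> 'a \<Rightarrow> 'a \<Rightarrow> bool" where
  "is_equalizer f g e \<longleftrightarrow>
     (\<exists>X Y E. f \<in> hom C X Y \<and> g \<in> hom C X Y \<and> e \<in> hom C E X \<and> f \<cdot> e = g \<cdot> e \<and>
        (\<forall>T h. h \<in> hom C T X \<and> f \<cdot> h = g \<cdot> h \<longrightarrow> (\<exists>!u. u \<in> hom C T E \<and> e \<cdot> u = h)))"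

definition is_coequalizer :: "'a \<Rightarrow> 'a \<Rightarrow> 'a \<Rightarrow> bool" where
  "is_coequalizer f g q \<longleftrightarrow>
     (\<exists>X Y Q. f \<in> hom C X Y \<and> g \<in> hom C X Y \<and> q \<in> hom C Y Q \<and> q \<cdot> f = q \<cdot> g \<and>
        (\<forall>T h. h \<in> hom C Y T \<and> h \<cdot> f = h \<cdot> g \<longrightarrow> (\<exists>!u. u \<in> hom C Q T \<and> u \<cdot> q = h)))"

definition has_equalizers :: bool where
  "has_equalizers \<longleftrightarrow>
     (\<forall>X Y f g. f \<in> hom C X Y \<and> g \<in> hom C X Y \<longrightarrow> (\<exists>e. is_equalizer f g e))"

definition has_coequalizers :: bool where
  "has_coequalizers \<longleftrightarrow>
     (\<forall>X Y f g. f \<in> hom C X Y \<and> g \<in> hom C X Y \<longrightarrow> (\<exists>q. is_coequalizer f g q))"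

text \<open>
  The square with \<open>f \<cdot> p\<^sub>1 = g \<cdot> p\<^sub>2\<close> is a pullback; \<open>p\<^sub>2\<close> is the pullback of \<open>f\<close> along \<open>g\<close>.
\<close>

definition is_pullback :: "'a \<Rightarrow> 'a \<Rightarrow> 'a \<Rightarrow> 'a \<Rightarrow> bool" where
  "is_pullback f g p\<^sub>1 p\<^sub>2 \<longleftrightarrow>
     (\<exists>X Y Z P. f \<in> hom C X Z \<and> g \<in> hom C Y Z \<and> p\<^sub>1 \<in> hom C P X \<and> p\<^sub>2 \<in> hom C P Y \<and>
        f \<cdot> p\<^sub>1 = g \<cdot> p\<^sub>2 \<and>
        (\<forall>T a b. a \<in> hom C T X \<and> b \<in> hom C T Y \<and> f \<cdot> a = g \<cdot> b \<longrightarrow>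
           (\<exists>!h. h \<in> hom C T P \<and> p\<^sub>1 \<cdot> h = a \<and> p\<^sub>2 \<cdot> h = b)))"

definition is_kernel_pair :: "'a \<Rightarrow> 'a \<Rightarrow> 'a \<Rightarrow> bool" where
  "is_kernel_pair f r\<^sub>1 r\<^sub>2 \<longleftrightarrow> is_pullback f f r\<^sub>1 r\<^sub>2"


section \<open>Classes of morphisms\<close>

definition is_mono :: "'a \<Rightarrow> bool" where
  "is_mono m \<longleftrightarrow>
     (\<exists>X Y. m \<in> hom C X Y \<and>
        (\<forall>T a b. a \<in> hom C T X \<and> b \<in> hom C T X \<and> m \<cdot> a = m \<cdot> b \<longrightarrow> a = b))"

definition is_iso :: "'a \<Rightarrow> bool" where
  "is_iso f \<longleftrightarrow>
     (\<exists>X Y g. f \<in> hom C X Y \<and> g \<in> hom C Y X \<and> g \<cdot> f = Id C X \<and> f \<cdot> g = Id C Y)"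

text \<open>\<open>p : X \<rightarrow> Y\<close> is a split epimorphism with section \<open>s : Y \<rightarrow> X\<close>.\<close>

definition is_split_epi :: "'o \<Rightarrow> 'o \<Rightarrow> 'a \<Rightarrow> 'a \<Rightarrow> bool" where
  "is_split_epi X Y p s \<longleftrightarrow> p \<in> hom C X Y \<and> s \<in> hom C Y X \<and> p \<cdot> s = Id C Y"

definition is_regular_epi :: "'a \<Rightarrow> bool" where
  "is_regular_epi q \<longleftrightarrow> (\<exists>f g. is_coequalizer f g q)"

text \<open>
  An image of \<open>f\<close> is the monomorphic part of a factorization of \<open>f\<close> as a regular epimorphism
  followed by a monomorphism.
\<close>

definition is_image :: "'a \<Rightarrow> 'a \<Rightarrow> bool" where
  "is_image f m \<longleftrightarrow>
     (\<exists>X I Y e. e \<in> hom C X I \<and> m \<in> hom C I Y \<and> is_regular_epi e \<and> is_mono m \<and> f = m \<cdot> e)"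


section \<open>Zero objects, kernels and cokernels\<close>

definition is_terminal :: "'o \<Rightarrow> bool" where
  "is_terminal Z \<longleftrightarrow> Z \<in> Ob C \<and> (\<forall>X\<in>Ob C. \<exists>!f. f \<in> hom C X Z)"

definition is_initial :: "'o \<Rightarrow> bool" where
  "is_initial Z \<longleftrightarrow> Z \<in> Ob C \<and> (\<forall>X\<in>Ob C. \<exists>!f. f \<in> hom C Z X)"

definition is_zero_object :: "'o \<Rightarrow> bool" where
  "is_zero_object Z \<longleftrightarrow> is_initial Z \<and> is_terminal Z"

definition pointed :: bool where
  "pointed \<longleftrightarrow> (\<exists>Z. is_zero_object Z)"

definition is_zero_arrow :: "'a \<Rightarrow> bool" where
  "is_zero_arrow z \<longleftrightarrow>
     (\<exists>X Y Z a b. is_zero_object Z \<and> a \<in> hom C X Z \<and> b \<in> hom C Z Y \<and> z = b \<cdot> a)"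

definition is_kernel_of :: "'a \<Rightarrow> 'a \<Rightarrow> bool" where
  "is_kernel_of f k \<longleftrightarrow> (\<exists>z. is_zero_arrow z \<and> is_equalizer f z k)"

definition is_cokernel_of :: "'a \<Rightarrow> 'a \<Rightarrow> bool" where
  "is_cokernel_of f q \<longleftrightarrow> (\<exists>z. is_zero_arrow z \<and> is_coequalizer f z q)"

definition is_kernel :: "'a \<Rightarrow> bool" where
  "is_kernel k \<longleftrightarrow> (\<exists>f. is_kernel_of f k)"

definition is_cokernel :: "'a \<Rightarrow> bool" where
  "is_cokernel q \<longleftrightarrow> (\<exists>f. is_cokernel_of f q)"


section \<open>Internal equivalence relations\<close>

text \<open>
  A relation on \<open>X\<close> is given by two jointly monic arrows \<open>r\<^sub>1, r\<^sub>2 : R \<rightarrow> X\<close>.  Transitivity is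
  witnessed on the pullback of \<open>r\<^sub>2\<close> along \<open>r\<^sub>1\<close>, the object of composable pairs: with
  \<open>r\<^sub>2 \<cdot> p\<^sub>1 = r\<^sub>1 \<cdot> p\<^sub>2\<close>, the pair \<open>(r\<^sub>1 \<cdot> p\<^sub>1, r\<^sub>2 \<cdot> p\<^sub>2)\<close> factors through \<open>(r\<^sub>1, r\<^sub>2)\<close>.
\<close>

definition is_equivalence_relation :: "'a \<Rightarrow> 'a \<Rightarrow> bool" where
  "is_equivalence_relation r\<^sub>1 r\<^sub>2 \<longleftrightarrow>
     (\<exists>R X. r\<^sub>1 \<in> hom C R X \<and> r\<^sub>2 \<in> hom C R X \<and>
        (\<forall>T a b. a \<in> hom C T R \<and> b \<in> hom C T R \<and> r\<^sub>1 \<cdot> a = r\<^sub>1 \<cdot> b \<and> r\<^sub>2 \<cdot> a = r\<^sub>2 \<cdot> b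
           \<longrightarrow> a = b) \<and>
        (\<exists>d. d \<in> hom C X R \<and> r\<^sub>1 \<cdot> d = Id C X \<and> r\<^sub>2 \<cdot> d = Id C X) \<and>
        (\<exists>\<sigma>. \<sigma> \<in> hom C R R \<and> r\<^sub>1 \<cdot> \<sigma> = r\<^sub>2 \<and> r\<^sub>2 \<cdot> \<sigma> = r\<^sub>1) \<and>
        (\<exists>P p\<^sub>1 p\<^sub>2 t. p\<^sub>1 \<in> hom C P R \<and> p\<^sub>2 \<in> hom C P R \<and> is_pullback r\<^sub>2 r\<^sub>1 p\<^sub>1 p\<^sub>2 \<and>
           t \<in> hom C P R \<and> r\<^sub>1 \<cdot> t = r\<^sub>1 \<cdot> p\<^sub>1 \<and> r\<^sub>2 \<cdot> t = r\<^sub>2 \<cdot> p\<^sub>2))"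

definition has_coequalizers_of_equivalence_relations :: bool where
  "has_coequalizers_of_equivalence_relations \<longleftrightarrow>
     (\<forall>r\<^sub>1 r\<^sub>2. is_equivalence_relation r\<^sub>1 r\<^sub>2 \<longrightarrow> (\<exists>q. is_coequalizer r\<^sub>1 r\<^sub>2 q))"


section \<open>Regular, exact, protomodular, homological and semi-abelian categories\<close>

definition regular :: bool where
  "regular \<longleftrightarrow>
     finitely_complete \<and>
     (\<forall>f g p\<^sub>1 p\<^sub>2. is_regular_epi f \<and> is_pullback f g p\<^sub>1 p\<^sub>2 \<longrightarrow> is_regular_epi p\<^sub>2) \<and>
     (\<forall>f r\<^sub>1 r\<^sub>2. is_kernel_pair f r\<^sub>1 r\<^sub>2 \<longrightarrow> (\<exists>q. is_coequalizer r\<^sub>1 r\<^sub>2 q))"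

definition exact :: bool where
  "exact \<longleftrightarrow>
     regular \<and>
     (\<forall>r\<^sub>1 r\<^sub>2. is_equivalence_relation r\<^sub>1 r\<^sub>2 \<longrightarrow> (\<exists>f. is_kernel_pair f r\<^sub>1 r\<^sub>2))"

definition split_short_five_lemma :: bool where
  "split_short_five_lemma \<longleftrightarrow>
     (\<forall>Z W q r L i X Y p s K k l m n.
        is_split_epi Z W q r \<and> i \<in> hom C L Z \<and> is_kernel_of q i \<and>
        is_split_epi X Y p s \<and> k \<in> hom C K X \<and> is_kernel_of p k \<and>
        l \<in> hom C L K \<and> m \<in> hom C Z X \<and> n \<in> hom C W Y \<and>
        m \<cdot> i = k \<cdot> l \<and> n \<cdot> q = p \<cdot> m \<and> m \<cdot> r = s \<cdot> n \<and>
        is_iso l \<and> is_iso n \<longrightarrow> is_iso m)"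

definition protomodular :: bool where
  "protomodular \<longleftrightarrow>
     pointed \<and>
     (\<forall>X Y W p s g. is_split_epi X Y p s \<and> g \<in> hom C W Y \<longrightarrow> (\<exists>p\<^sub>1 p\<^sub>2. is_pullback p g p\<^sub>1 p\<^sub>2)) \<and>
     split_short_five_lemma"

definition homological :: bool where
  "homological \<longleftrightarrow> pointed \<and> regular \<and> protomodular"

definition semi_abelian :: bool where
  "semi_abelian \<longleftrightarrow> pointed \<and> exact \<and> protomodular \<and> has_finite_coproducts"


section \<open>The axioms\<close>

definition axiom_A1 :: bool where
  "axiom_A1 \<longleftrightarrow>
     pointed \<and> has_finite_products \<and> has_finite_coproducts \<and> has_equalizers \<and> has_coequalizers"

definition axiom_A1' :: bool where
  "axiom_A1' \<longleftrightarrow>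
     pointed \<and> has_finite_products \<and> has_finite_coproducts \<and> has_equalizers \<and>
     has_coequalizers_of_equivalence_relations"

text \<open>
  Kernels, coproducts, pullbacks and images are only determined up to isomorphism; the axioms
  below are required for every choice of them.
\<close>

definition axiom_A2 :: bool where
  "axiom_A2 \<longleftrightarrow>
     (\<forall>X Y p s K k S \<iota>\<^sub>1 \<iota>\<^sub>2 u.
        is_split_epi X Y p s \<and> k \<in> hom C K X \<and> is_kernel_of p k \<and>
        is_binary_coproduct K Y S \<iota>\<^sub>1 \<iota>\<^sub>2 \<and>
        u \<in> hom C S X \<and> u \<cdot> \<iota>\<^sub>1 = k \<and> u \<cdot> \<iota>\<^sub>2 = s \<longrightarrow> is_cokernel u)"

definition axiom_A3 :: bool where
  "axiom_A3 \<longleftrightarrow>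
     (\<forall>q g p\<^sub>1 p\<^sub>2. is_cokernel q \<and> is_pullback q g p\<^sub>1 p\<^sub>2 \<longrightarrow> is_cokernel p\<^sub>2)"

definition axiom_A4 :: bool where
  "axiom_A4 \<longleftrightarrow>
     (\<forall>K X Y k q m. k \<in> hom C K X \<and> q \<in> hom C X Y \<and> is_kernel k \<and> is_cokernel q \<and>
        is_image (q \<cdot> k) m \<longrightarrow> is_kernel m)"

end

end

theory Submission
  imports Defs
begin

text \<open>
  The four equivalences come down to one property of a pointed category with finite limits, the
  locale \<open>generated_points\<close>: if \<open>p\<close> is a split epimorphism with section \<open>s\<close> and kernel \<open>k\<close>, then a
  subobject of its domain through which \<open>k\<close> and \<open>s\<close> factor is everything.  With finite coproducts,
  A2 gives it: a cokernel \<open>\<langle>k, s\<rangle>\<close> that factors through a monomorphism makes the monomorphism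
  invertible.  Protomodularity gives it by the split short five lemma
  (\<open>generated_points_from_A2\<close>, \<open>generated_points_from_protomodular\<close>).  Conversely the property yields
  the split short five lemma and, in a regular category, A2: the image of \<open>\<langle>k, s\<rangle>\<close> contains
  \<open>k\<close> and \<open>s\<close>, so \<open>\<langle>k, s\<rangle>\<close> is a regular epimorphism.

  Two consequences of the property do the rest.  First, applied to the projection of a kernel pair,
  split by the diagonal, it shows that a map is constant on the classes of the kernel pair as soon
  as it kills the kernel.  Hence regular epimorphisms are the same as cokernels
  (\<open>regular_epi_is_cokernel\<close>), and A3 is the stability of regular epimorphisms under pullback.
  Secondly, every relation is difunctional, so every reflexive relation is an equivalence relation
  (\<open>difunctional\<close>, \<open>reflexive_relation_is_equivalence\<close>).  Kernel pairs in particular are equivalence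
  relations, so A1' suffices for regularity; and arbitrary coequalizers are reduced to those of
  equivalence relations by passing to the image of a reflexive graph
  (\<open>coequalizers_from_equivalence_relations\<close>).  This also supplies the coequalizers of a semi-abelian
  category, where equivalence relations are kernel pairs.

  Exactness and A4 are compared through the normalization of an equivalence relation
  \<open>(r\<^sub>1, r\<^sub>2)\<close>, which is \<open>r\<^sub>2 \<cdot> ker r\<^sub>1\<close>.  A4 makes the normalization the kernel of some \<open>f\<close>, and
  the property above then identifies the relation with the kernel pair of \<open>f\<close> (\<open>exact_from_A4\<close>).
  In the other direction the image under \<open>q\<close> of the kernel pair of \<open>f\<close> is an equivalence relation
  whose normalization is the image under \<open>q\<close> of the kernel of \<open>f\<close>; exactness makes it a kernel pair, so
  that its normalization is a kernel (\<open>A4_from_exact\<close>).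

  Elements are generalized elements \<open>T \<rightarrow> X\<close>; in a regular category they lift along a regular
  epimorphism once \<open>T\<close> is replaced by a cover of it, i.e. by the domain of a regular epimorphism.
\<close>

section \<open>Calculating in a category\<close>

context category
begin

lemma homD:
  assumes "f \<in> hom C X Y"
  shows "f \<in> Ar C" "Dom C f = X" "Cod C f = Y" "X \<in> Ob C" "Y \<in> Ob C"
  using assms dom_in_Ob cod_in_Ob by (auto simp: hom_def)

lemma comp_typing [simp]:
  assumes "f \<in> Ar C" "g \<in> Ar C" "Cod C f = Dom C g"
  shows "g \<cdot> f \<in> Ar C" "Dom C (g \<cdot> f) = Dom C f" "Cod C (g \<cdot> f) = Cod C g"
  using comp_in_hom[of f "Dom C f" "Cod C f" g "Cod C g"] assms by (auto simp: hom_def)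

lemma id_typing [simp]:
  assumes "X \<in> Ob C"
  shows "Id C X \<in> Ar C" "Dom C (Id C X) = X" "Cod C (Id C X) = X"
  using id_in_hom[OF assms] by (auto simp: hom_def)

lemma comp_id_left [simp]: "\<lbrakk>f \<in> Ar C; Cod C f = X\<rbrakk> \<Longrightarrow> Id C X \<cdot> f = f"
  using id_comp by (auto simp: hom_def)

lemma comp_id_right [simp]: "\<lbrakk>f \<in> Ar C; Dom C f = X\<rbrakk> \<Longrightarrow> f \<cdot> Id C X = f"
  using comp_id by (auto simp: hom_def)

lemma assoc [simp]:
  assumes "f \<in> Ar C" "g \<in> Ar C" "h \<in> Ar C" "Cod C f = Dom C g" "Cod C g = Dom C h"
  shows "(h \<cdot> g) \<cdot> f = h \<cdot> (g \<cdot> f)"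
  using comp_assoc[of f "Dom C f" "Cod C f" g "Cod C g" h "Cod C h"] assms
  by (auto simp: hom_def)

text \<open>
  Composites are kept associated to the right, so an equation between composites of two arrows
  does not match inside a longer composite; this is the form of it that does.
\<close>

lemma whisker:
  assumes "g \<cdot> f = k" "f \<in> Ar C" "g \<in> Ar C" "h \<in> Ar C" "Cod C f = Dom C g" "Cod C h = Dom C f"
  shows "g \<cdot> (f \<cdot> h) = k \<cdot> h"
  using assms assoc[of h f g] by simp

lemma mono_cancel:
  assumes "is_mono C m" "m \<in> hom C X Y" "a \<in> hom C T X" "b \<in> hom C T X" "m \<cdot> a = m \<cdot> b"
  shows "a = b"
proof -
  obtain X' Y' where "m \<in> hom C X' Y'"
    and *: "\<And>T a b. \<lbrakk>a \<in> hom C T X'; b \<in> hom C T X'; m \<cdot> a = m \<cdot> b\<rbrakk> \<Longrightarrow> a = b"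
    using assms(1) unfolding is_mono_def by blast
  then have "X' = X" using assms(2) by (simp add: hom_def)
  then show ?thesis using * assms(3-5) by blast
qed

end

section \<open>Limits from products and equalizers, and duality\<close>

text \<open>Two objects 0 and 1, with identities 0 and 1, and two parallel arrows 2 and 3 from 0 to 1.\<close>

definition parallel_pair :: "(nat, nat) precat" where
  "parallel_pair = \<lparr>Ob = {0, 1}, Ar = {0, 1, 2, 3}, Dom = (\<lambda>u. if u = 1 then 1 else 0),
     Cod = (\<lambda>u. if u = 0 then 0 else 1), Id = (\<lambda>j. j), Comp = (\<lambda>v u. if v \<le> 1 then u else v)\<rparr>"

lemma parallel_pair_simps:
  "Ob parallel_pair = {0, 1}" "Ar parallel_pair = {0, 1, 2, 3}" "Id parallel_pair j = j"
  "Dom parallel_pair u = (if u = 1 then 1 else 0)"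
  "Cod parallel_pair u = (if u = 0 then 0 else 1)"
  "Comp parallel_pair v u = (if v \<le> 1 then u else v)"
  by (simp_all add: parallel_pair_def)

lemma category_parallel_pair: "category parallel_pair"
proof -
  have hom: "u \<in> hom parallel_pair i j \<longleftrightarrow>
      i = 0 \<and> j = 0 \<and> u = 0 \<or> i = 1 \<and> j = 1 \<and> u = 1 \<or> i = 0 \<and> j = 1 \<and> (u = 2 \<or> u = 3)" for u i j
    by (auto simp: hom_def parallel_pair_simps)
  show ?thesis
  proof
    fix f g i j k
    show "f \<in> Ar parallel_pair \<Longrightarrow> Dom parallel_pair f \<in> Ob parallel_pair"
      "f \<in> Ar parallel_pair \<Longrightarrow> Cod parallel_pair f \<in> Ob parallel_pair"
      by (simp_all add: parallel_pair_simps)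
    show "j \<in> Ob parallel_pair \<Longrightarrow> Id parallel_pair j \<in> hom parallel_pair j j"
      by (auto simp: hom parallel_pair_simps)
    show "\<lbrakk>f \<in> hom parallel_pair i j; g \<in> hom parallel_pair j k\<rbrakk>
        \<Longrightarrow> g \<cdot>\<^bsub>parallel_pair\<^esub> f \<in> hom parallel_pair i k"
      "f \<in> hom parallel_pair i j \<Longrightarrow> f \<cdot>\<^bsub>parallel_pair\<^esub> Id parallel_pair i = f"
      "f \<in> hom parallel_pair i j \<Longrightarrow> Id parallel_pair j \<cdot>\<^bsub>parallel_pair\<^esub> f = f"
      unfolding hom parallel_pair_simps by (elim disjE conjE; simp)+
    show "(h \<cdot>\<^bsub>parallel_pair\<^esub> g) \<cdot>\<^bsub>parallel_pair\<^esub> f = h \<cdot>\<^bsub>parallel_pair\<^esub> (g \<cdot>\<^bsub>parallel_pair\<^esub> f)" for h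
      by (simp add: parallel_pair_simps)
  qed
qed

context category
begin

lemma productE:
  assumes "is_product C I X P \<pi>"
  obtains "P \<in> Ob C" "\<And>i. i \<in> I \<Longrightarrow> \<pi> i \<in> hom C P (X i)"
    "\<And>T \<tau>. \<lbrakk>T \<in> Ob C; \<And>i. i \<in> I \<Longrightarrow> \<tau> i \<in> hom C T (X i)\<rbrakk>
       \<Longrightarrow> \<exists>h. h \<in> hom C T P \<and> (\<forall>i\<in>I. \<pi> i \<cdot> h = \<tau> i)"
    "\<And>T h h'. \<lbrakk>h \<in> hom C T P; h' \<in> hom C T P; \<And>i. i \<in> I \<Longrightarrow> \<pi> i \<cdot> h = \<pi> i \<cdot> h'\<rbrakk> \<Longrightarrow> h = h'"
proof -
  have uniq: "h = h'"
    if h: "h \<in> hom C T P" and h': "h' \<in> hom C T P" and eq: "\<And>i. i \<in> I \<Longrightarrow> \<pi> i \<cdot> h = \<pi> i \<cdot> h'"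
    for T h h'
  proof -
    have "T \<in> Ob C" using homD(4)[OF h] .
    moreover have "\<forall>i\<in>I. \<pi> i \<cdot> h \<in> hom C T (X i)"
      using assms h comp_in_hom by (fastforce simp: is_product_def)
    ultimately have "\<exists>!k. k \<in> hom C T P \<and> (\<forall>i\<in>I. \<pi> i \<cdot> k = \<pi> i \<cdot> h)"
      using assms unfolding is_product_def by (elim conjE) (drule bspec, assumption, simp)
    then show ?thesis using h h' eq by (metis (no_types, lifting))
  qed
  have ex: "\<exists>h. h \<in> hom C T P \<and> (\<forall>i\<in>I. \<pi> i \<cdot> h = \<tau> i)"
    if "T \<in> Ob C" "\<And>i. i \<in> I \<Longrightarrow> \<tau> i \<in> hom C T (X i)" for T \<tau>
  proof -
    have "\<forall>i\<in>I. \<tau> i \<in> hom C T (X i)" using that(2) by blast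
    then show ?thesis using assms that(1) unfolding is_product_def by blast
  qed
  have "P \<in> Ob C" "\<And>i. i \<in> I \<Longrightarrow> \<pi> i \<in> hom C P (X i)"
    using assms unfolding is_product_def by blast+
  then show ?thesis using ex uniq by (rule that)
qed

lemma equalizerE:
  assumes "is_equalizer C f g e"
  obtains X Y E where "f \<in> hom C X Y" "g \<in> hom C X Y" "e \<in> hom C E X" "f \<cdot> e = g \<cdot> e"
    "\<And>T h. \<lbrakk>h \<in> hom C T X; f \<cdot> h = g \<cdot> h\<rbrakk> \<Longrightarrow> \<exists>u. u \<in> hom C T E \<and> e \<cdot> u = h"
    "is_mono C e"
proof -
  obtain X Y E where *: "f \<in> hom C X Y" "g \<in> hom C X Y" "e \<in> hom C E X" "f \<cdot> e = g \<cdot> e"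
    "\<And>T h. \<lbrakk>h \<in> hom C T X; f \<cdot> h = g \<cdot> h\<rbrakk> \<Longrightarrow> \<exists>!u. u \<in> hom C T E \<and> e \<cdot> u = h"
    using assms unfolding is_equalizer_def by blast
  have "a = b" if ab: "a \<in> hom C T E" "b \<in> hom C T E" "e \<cdot> a = e \<cdot> b" for T a b
  proof -
    have "f \<cdot> (e \<cdot> a) = g \<cdot> (e \<cdot> a)"
      using *(1-3) ab whisker[OF *(4)] by (simp add: hom_def)
    then show ?thesis
      using *(5)[of "e \<cdot> a" T] ab comp_in_hom[OF ab(1) *(3)] by metis
  qed
  then have "is_mono C e" using *(3) unfolding is_mono_def by blast
  then show ?thesis using that[of X Y E] * by metis
qed

lemma coequalizerE:
  assumes "is_coequalizer C f g q"
  obtains X Y Q where "f \<in> hom C X Y" "g \<in> hom C X Y" "q \<in> hom C Y Q" "q \<cdot> f = q \<cdot> g"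
    "\<And>T h. \<lbrakk>h \<in> hom C Y T; h \<cdot> f = h \<cdot> g\<rbrakk> \<Longrightarrow> \<exists>u. u \<in> hom C Q T \<and> u \<cdot> q = h"
    "\<And>T a b. \<lbrakk>a \<in> hom C Q T; b \<in> hom C Q T; a \<cdot> q = b \<cdot> q\<rbrakk> \<Longrightarrow> a = b"
proof -
  obtain X Y Q where *: "f \<in> hom C X Y" "g \<in> hom C X Y" "q \<in> hom C Y Q" "q \<cdot> f = q \<cdot> g"
    "\<And>T h. \<lbrakk>h \<in> hom C Y T; h \<cdot> f = h \<cdot> g\<rbrakk> \<Longrightarrow> \<exists>!u. u \<in> hom C Q T \<and> u \<cdot> q = h"
    using assms unfolding is_coequalizer_def by blast
  have "a = b" if ab: "a \<in> hom C Q T" "b \<in> hom C Q T" "a \<cdot> q = b \<cdot> q" for T a b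
  proof -
    have "(a \<cdot> q) \<cdot> f = (a \<cdot> q) \<cdot> g"
      using *(1-4) ab by (simp add: hom_def)
    then show ?thesis
      using *(5)[of "a \<cdot> q" T] ab comp_in_hom[OF *(3) ab(1)] by metis
  qed
  then show ?thesis using that[of X Y Q] * by metis
qed

theorem finitely_complete_from_products_equalizers:
  assumes "has_finite_products C" "has_equalizers C"
  shows "finitely_complete C"
  unfolding finitely_complete_def
proof (intro allI impI, elim conjE)
  fix J :: "(nat, nat) precat" and Fo Fa
  assume "category J" and fin: "finite (Ob J)" "finite (Ar J)" and F: "is_functor J C Fo Fa"
  then interpret J: category J by simp
  have Fo: "\<And>j. j \<in> Ob J \<Longrightarrow> Fo j \<in> Ob C"
    and Fa: "\<And>u. u \<in> Ar J \<Longrightarrow> Fa u \<in> hom C (Fo (Dom J u)) (Fo (Cod J u))"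
    using F by (auto simp: is_functor_def)
  obtain P \<pi> where "is_product C (Ob J) Fo P \<pi>"
    using assms(1) fin Fo unfolding has_finite_products_def by metis
  then obtain P: "P \<in> Ob C" and \<pi>: "\<And>j. j \<in> Ob J \<Longrightarrow> \<pi> j \<in> hom C P (Fo j)"
    and Pex: "\<And>T \<tau>. \<lbrakk>T \<in> Ob C; \<And>j. j \<in> Ob J \<Longrightarrow> \<tau> j \<in> hom C T (Fo j)\<rbrakk>
       \<Longrightarrow> \<exists>h. h \<in> hom C T P \<and> (\<forall>j\<in>Ob J. \<pi> j \<cdot> h = \<tau> j)"
    and Puq: "\<And>T h h'. \<lbrakk>h \<in> hom C T P; h' \<in> hom C T P; \<And>j. j \<in> Ob J \<Longrightarrow> \<pi> j \<cdot> h = \<pi> j \<cdot> h'\<rbrakk>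
       \<Longrightarrow> h = h'"
    using productE by blast
  obtain Q \<rho> where "is_product C (Ar J) (\<lambda>u. Fo (Cod J u)) Q \<rho>"
    using assms(1) fin Fo J.cod_in_Ob unfolding has_finite_products_def
    by (metis (no_types, lifting))
  then obtain Q: "Q \<in> Ob C" and \<rho>: "\<And>u. u \<in> Ar J \<Longrightarrow> \<rho> u \<in> hom C Q (Fo (Cod J u))"
    and Qex: "\<And>T \<tau>. \<lbrakk>T \<in> Ob C; \<And>u. u \<in> Ar J \<Longrightarrow> \<tau> u \<in> hom C T (Fo (Cod J u))\<rbrakk>
       \<Longrightarrow> \<exists>h. h \<in> hom C T Q \<and> (\<forall>u\<in>Ar J. \<rho> u \<cdot> h = \<tau> u)"
    and Quq: "\<And>T h h'. \<lbrakk>h \<in> hom C T Q; h' \<in> hom C T Q; \<And>u. u \<in> Ar J \<Longrightarrow> \<rho> u \<cdot> h = \<rho> u \<cdot> h'\<rbrakk>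
       \<Longrightarrow> h = h'"
    using productE by blast
  \<comment> \<open>a map into the product over the objects is a cone exactly if it equalizes these two\<close>
  obtain f where f: "f \<in> hom C P Q" "\<And>u. u \<in> Ar J \<Longrightarrow> \<rho> u \<cdot> f = \<pi> (Cod J u)"
    using Qex[of P "\<lambda>u. \<pi> (Cod J u)", OF P \<pi>[OF J.cod_in_Ob]] by blast
  have "\<And>u. u \<in> Ar J \<Longrightarrow> Fa u \<cdot> \<pi> (Dom J u) \<in> hom C P (Fo (Cod J u))"
    by (rule comp_in_hom[OF \<pi>[OF J.dom_in_Ob] Fa])
  then obtain g where g: "g \<in> hom C P Q" "\<And>u. u \<in> Ar J \<Longrightarrow> \<rho> u \<cdot> g = Fa u \<cdot> \<pi> (Dom J u)"
    using Qex[of P "\<lambda>u. Fa u \<cdot> \<pi> (Dom J u)", OF P] by blast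
  obtain e where "is_equalizer C f g e"
    using assms(2) f(1) g(1) unfolding has_equalizers_def by blast
  then obtain E where e: "e \<in> hom C E P" "f \<cdot> e = g \<cdot> e" and mono: "is_mono C e"
    and ex: "\<And>T h. \<lbrakk>h \<in> hom C T P; f \<cdot> h = g \<cdot> h\<rbrakk> \<Longrightarrow> \<exists>u. u \<in> hom C T E \<and> e \<cdot> u = h"
    using f(1) by (elim equalizerE) (auto simp: hom_def)
  have cone: "is_cone C J Fo Fa E (\<lambda>j. \<pi> j \<cdot> e)"
    unfolding is_cone_def
  proof (intro conjI ballI)
    show "E \<in> Ob C" using homD[OF e(1)] by simp
    show "\<pi> j \<cdot> e \<in> hom C E (Fo j)" if "j \<in> Ob J" for j
      using comp_in_hom[OF e(1) \<pi>[OF that]] .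
    show "Fa u \<cdot> (\<pi> (Dom J u) \<cdot> e) = \<pi> (Cod J u) \<cdot> e" if u: "u \<in> Ar J" for u
    proof -
      have "Fa u \<cdot> (\<pi> (Dom J u) \<cdot> e) = (\<rho> u \<cdot> g) \<cdot> e"
        using g(2)[OF u] Fa[OF u] \<pi>[OF J.dom_in_Ob[OF u]] e(1) by (simp add: hom_def)
      also have "\<dots> = (\<rho> u \<cdot> f) \<cdot> e"
        using \<rho>[OF u] e f(1) g(1) by (simp add: hom_def)
      finally show ?thesis using f(2)[OF u] by simp
    qed
  qed
  have "\<exists>!h. h \<in> hom C T E \<and> (\<forall>j\<in>Ob J. (\<pi> j \<cdot> e) \<cdot> h = \<tau> j)"
    if \<tau>: "is_cone C J Fo Fa T \<tau>" for T \<tau>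
  proof -
    from \<tau> have T: "T \<in> Ob C" and \<tau>h: "\<And>j. j \<in> Ob J \<Longrightarrow> \<tau> j \<in> hom C T (Fo j)"
      and \<tau>u: "\<And>u. u \<in> Ar J \<Longrightarrow> Fa u \<cdot> \<tau> (Dom J u) = \<tau> (Cod J u)"
      by (auto simp: is_cone_def)
    obtain h where h: "h \<in> hom C T P" "\<And>j. j \<in> Ob J \<Longrightarrow> \<pi> j \<cdot> h = \<tau> j"
      using Pex[OF T \<tau>h] by blast
    have "f \<cdot> h = g \<cdot> h"
    proof (rule Quq)
      show "f \<cdot> h \<in> hom C T Q" "g \<cdot> h \<in> hom C T Q" using comp_in_hom h f g by blast+
      fix u assume u: "u \<in> Ar J"
      have "\<rho> u \<cdot> (f \<cdot> h) = \<tau> (Cod J u)"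
        using whisker[OF f(2)[OF u]] \<rho>[OF u] f(1) h J.cod_in_Ob[OF u] by (simp add: hom_def)
      moreover have "\<rho> u \<cdot> (g \<cdot> h) = Fa u \<cdot> \<tau> (Dom J u)"
        using whisker[OF g(2)[OF u]] \<rho>[OF u] g(1) h Fa[OF u] \<pi>[OF J.dom_in_Ob[OF u]]
          J.dom_in_Ob[OF u] by (simp add: hom_def)
      ultimately show "\<rho> u \<cdot> (f \<cdot> h) = \<rho> u \<cdot> (g \<cdot> h)" using \<tau>u[OF u] by simp
    qed
    then obtain k where k: "k \<in> hom C T E" "e \<cdot> k = h" using ex h(1) by blast
    have along: "(\<pi> j \<cdot> e) \<cdot> k' = \<pi> j \<cdot> (e \<cdot> k')" if "j \<in> Ob J" "k' \<in> hom C T E" for j k'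
      using \<pi>[OF that(1)] that(2) e(1) by (simp add: hom_def)
    show ?thesis
    proof (rule ex1I[of _ k])
      show "k \<in> hom C T E \<and> (\<forall>j\<in>Ob J. (\<pi> j \<cdot> e) \<cdot> k = \<tau> j)"
        using k h(2) along by simp
    next
      fix k' assume k': "k' \<in> hom C T E \<and> (\<forall>j\<in>Ob J. (\<pi> j \<cdot> e) \<cdot> k' = \<tau> j)"
      then have "\<pi> j \<cdot> (e \<cdot> k') = \<pi> j \<cdot> h" if "j \<in> Ob J" for j
        using that along h(2) by metis
      then have "e \<cdot> k' = h"
        using Puq comp_in_hom[OF _ e(1)] k' h(1) by blast
      then show "k' = k"
        using mono_cancel[OF mono e(1)] k k' by blast
    qed
  qed
  then show "\<exists>L \<pi>. is_limit C J Fo Fa L \<pi>"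
    using cone unfolding is_limit_def by blast
qed

theorem finite_products_from_finitely_complete:
  assumes "finitely_complete C"
  shows "has_finite_products C"
  unfolding has_finite_products_def
proof (intro allI impI, elim conjE)
  fix I :: "nat set" and X assume I: "finite I" and X: "\<forall>i\<in>I. X i \<in> Ob C"
  define J :: "(nat, nat) precat"
    where "J = \<lparr>Ob = I, Ar = I, Dom = id, Cod = id, Id = id, Comp = \<lambda>g f. f\<rparr>"
  have "category J" by unfold_locales (auto simp: J_def hom_def)
  moreover have "is_functor J C X (\<lambda>i. Id C (X i))"
    using X id_in_hom by (auto simp: is_functor_def J_def)
  ultimately obtain P \<pi> where L: "is_limit C J X (\<lambda>i. Id C (X i)) P \<pi>"
    using assms I unfolding finitely_complete_def by (fastforce simp: J_def)
  have cone: "is_cone C J X (\<lambda>i. Id C (X i)) T \<tau> \<longleftrightarrow> T \<in> Ob C \<and> (\<forall>i\<in>I. \<tau> i \<in> hom C T (X i))"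
    for T \<tau> by (auto simp: is_cone_def J_def hom_def)
  have "Ob J = I" by (simp add: J_def)
  then have "is_product C I X P \<pi>"
    using L unfolding is_limit_def is_product_def cone by auto
  then show "\<exists>P \<pi>. is_product C I X P \<pi>" by blast
qed

theorem equalizers_from_finitely_complete:
  assumes "finitely_complete C"
  shows "has_equalizers C"
  unfolding has_equalizers_def
proof (intro allI impI, elim conjE)
  fix X Y f g assume f: "f \<in> hom C X Y" and g: "g \<in> hom C X Y"
  define Fo where "Fo = (\<lambda>j::nat. if j = 0 then X else Y)"
  define Fa where
    "Fa = (\<lambda>u::nat. if u = 0 then Id C X else if u = 1 then Id C Y else if u = 2 then f else g)"
  have XY: "X \<in> Ob C" "Y \<in> Ob C" using homD[OF f] by simp_all
  have "is_functor parallel_pair C Fo Fa"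
    using XY f g by (auto simp: is_functor_def parallel_pair_simps Fo_def Fa_def hom_def)
  moreover have "finite (Ob parallel_pair)" "finite (Ar parallel_pair)"
    by (simp_all add: parallel_pair_simps)
  ultimately obtain E \<pi> where L: "is_limit C parallel_pair Fo Fa E \<pi>"
    using assms category_parallel_pair unfolding finitely_complete_def by blast
  have cone: "is_cone C parallel_pair Fo Fa T \<tau> \<longleftrightarrow> \<tau> 0 \<in> hom C T X \<and> f \<cdot> \<tau> 0 = \<tau> 1 \<and> g \<cdot> \<tau> 0 = \<tau> 1"
    for T \<tau>
  proof -
    have "is_cone C parallel_pair Fo Fa T \<tau> \<longleftrightarrow>
        \<tau> 0 \<in> hom C T X \<and> \<tau> 1 \<in> hom C T Y \<and> f \<cdot> \<tau> 0 = \<tau> 1 \<and> g \<cdot> \<tau> 0 = \<tau> 1"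
      using XY f g dom_in_Ob
      by (auto simp: is_cone_def parallel_pair_simps Fo_def Fa_def hom_def)
    then show ?thesis using comp_in_hom[OF _ f, of "\<tau> 0" T] by auto
  qed
  have "is_equalizer C f g (\<pi> 0)"
    unfolding is_equalizer_def
  proof (intro exI conjI allI impI)
    show "f \<in> hom C X Y" "g \<in> hom C X Y" by fact+
    show \<pi>0: "\<pi> 0 \<in> hom C E X" and eq: "f \<cdot> \<pi> 0 = g \<cdot> \<pi> 0"
      using L unfolding is_limit_def cone by simp_all
    fix T h assume h: "h \<in> hom C T X \<and> f \<cdot> h = g \<cdot> h"
    define \<tau> where "\<tau> = (\<lambda>j::nat. if j = 0 then h else f \<cdot> h)"
    have "is_cone C parallel_pair Fo Fa T \<tau>" using h unfolding cone by (simp add: \<tau>_def)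
    then have "\<exists>!u. u \<in> hom C T E \<and> (\<forall>j\<in>Ob parallel_pair. \<pi> j \<cdot> u = \<tau> j)"
      using L unfolding is_limit_def by blast
    moreover have "(\<forall>j\<in>Ob parallel_pair. \<pi> j \<cdot> u = \<tau> j) \<longleftrightarrow> \<pi> 0 \<cdot> u = h" if u: "u \<in> hom C T E" for u
    proof -
      have "\<pi> 1 = f \<cdot> \<pi> 0" using L unfolding is_limit_def cone by simp
      then have "\<pi> 1 \<cdot> u = f \<cdot> (\<pi> 0 \<cdot> u)" using f \<pi>0 u by (simp add: hom_def)
      then show ?thesis by (auto simp: parallel_pair_simps \<tau>_def)
    qed
    ultimately show "\<exists>!u. u \<in> hom C T E \<and> \<pi> 0 \<cdot> u = h" by (metis (no_types, lifting))
  qed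
  then show "\<exists>e. is_equalizer C f g e" ..
qed

end

definition opposite :: "('o, 'a) precat \<Rightarrow> ('o, 'a) precat" where
  "opposite C = \<lparr>Ob = Ob C, Ar = Ar C, Dom = Cod C, Cod = Dom C, Id = Id C,
     Comp = (\<lambda>g f. Comp C f g)\<rparr>"

lemma opposite_simps [simp]:
  "Ob (opposite C) = Ob C" "Ar (opposite C) = Ar C" "Dom (opposite C) = Cod C"
  "Cod (opposite C) = Dom C" "Id (opposite C) = Id C" "Comp (opposite C) g f = Comp C f g"
  "opposite (opposite C) = C"
  by (simp_all add: opposite_def)

lemma hom_opposite [simp]: "hom (opposite C) X Y = hom C Y X"
  by (auto simp: hom_def)

lemma category_opposite:
  assumes "category C"
  shows "category (opposite C)"
proof -
  interpret category C by (rule assms)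
  show ?thesis by unfold_locales (auto simp: hom_def dom_in_Ob cod_in_Ob)
qed

lemma finitely_cocomplete_opposite: "finitely_cocomplete C \<longleftrightarrow> finitely_complete (opposite C)"
proof -
  have colimit: "is_limit (opposite C) (opposite J) Fo Fa = is_colimit C J Fo Fa"
    for J :: "(nat, nat) precat" and Fo Fa
    by (intro ext) (simp add: is_limit_def is_colimit_def is_cone_def is_cocone_def)
  have functors: "is_functor (opposite J) (opposite C) Fo Fa \<longleftrightarrow> is_functor J C Fo Fa"
    for J :: "(nat, nat) precat" and Fo Fa
    by (auto simp: is_functor_def)
  have diagram: "category (opposite J) \<longleftrightarrow> category J" for J :: "(nat, nat) precat"
    using category_opposite[of J] category_opposite[of "opposite J"] by auto
  have all_op: "(\<forall>J::(nat, nat) precat. P J) \<longleftrightarrow> (\<forall>J. P (opposite J))" for P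
    by (metis opposite_simps(7))
  show ?thesis
    unfolding finitely_cocomplete_def finitely_complete_def
    by (subst (2) all_op) (simp add: colimit functors diagram)
qed

lemma has_finite_coproducts_opposite: "has_finite_coproducts C \<longleftrightarrow> has_finite_products (opposite C)"
  by (simp add: has_finite_coproducts_def has_finite_products_def is_product_def is_coproduct_def)

lemma has_coequalizers_opposite: "has_coequalizers C \<longleftrightarrow> has_equalizers (opposite C)"
proof -
  have "is_equalizer (opposite C) f g e \<longleftrightarrow> is_coequalizer C f g e" for f g e
    unfolding is_equalizer_def is_coequalizer_def by (simp, blast)
  then show ?thesis unfolding has_coequalizers_def has_equalizers_def by (simp, blast)
qed

theorem (in category) finitely_complete_iff:
  "finitely_complete C \<longleftrightarrow> has_finite_products C \<and> has_equalizers C"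
  using finitely_complete_from_products_equalizers finite_products_from_finitely_complete
    equalizers_from_finitely_complete by blast

theorem (in category) finitely_cocomplete_iff:
  "finitely_cocomplete C \<longleftrightarrow> has_finite_coproducts C \<and> has_coequalizers C"
  using category.finitely_complete_iff[OF category_opposite[OF category_axioms]]
  by (simp add: finitely_cocomplete_opposite has_finite_coproducts_opposite
      has_coequalizers_opposite)


section \<open>Monomorphisms, regular epimorphisms and pullbacks\<close>

context category
begin

lemma is_monoI:
  assumes "m \<in> hom C X Y" "\<And>T a b. \<lbrakk>a \<in> hom C T X; b \<in> hom C T X; m \<cdot> a = m \<cdot> b\<rbrakk> \<Longrightarrow> a = b"
  shows "is_mono C m"
  using assms unfolding is_mono_def by blast

lemma equalizerI:
  assumes "f \<in> hom C X Y" "g \<in> hom C X Y" "e \<in> hom C E X" "f \<cdot> e = g \<cdot> e" "is_mono C e"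
    "\<And>T h. \<lbrakk>h \<in> hom C T X; f \<cdot> h = g \<cdot> h\<rbrakk> \<Longrightarrow> \<exists>u. u \<in> hom C T E \<and> e \<cdot> u = h"
  shows "is_equalizer C f g e"
proof -
  have "\<exists>!u. u \<in> hom C T E \<and> e \<cdot> u = h" if "h \<in> hom C T X \<and> f \<cdot> h = g \<cdot> h" for T h
    using assms(6)[of h T] that mono_cancel[OF assms(5,3)] by blast
  then show ?thesis using assms(1-4) unfolding is_equalizer_def by blast
qed

lemma coequalizerI:
  assumes "f \<in> hom C X Y" "g \<in> hom C X Y" "q \<in> hom C Y Q" "q \<cdot> f = q \<cdot> g"
    "\<And>T a b. \<lbrakk>a \<in> hom C Q T; b \<in> hom C Q T; a \<cdot> q = b \<cdot> q\<rbrakk> \<Longrightarrow> a = b"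
    "\<And>T h. \<lbrakk>h \<in> hom C Y T; h \<cdot> f = h \<cdot> g\<rbrakk> \<Longrightarrow> \<exists>u. u \<in> hom C Q T \<and> u \<cdot> q = h"
  shows "is_coequalizer C f g q"
proof -
  have "\<exists>!u. u \<in> hom C Q T \<and> u \<cdot> q = h" if "h \<in> hom C Y T \<and> h \<cdot> f = h \<cdot> g" for T h
    using assms(6)[of h T] that assms(5) by blast
  then show ?thesis using assms(1-4) unfolding is_coequalizer_def by blast
qed

lemma regular_epiE:
  assumes "is_regular_epi C q" "q \<in> hom C Y Q"
  obtains X f g where "f \<in> hom C X Y" "g \<in> hom C X Y" "q \<cdot> f = q \<cdot> g"
    "\<And>T h. \<lbrakk>h \<in> hom C Y T; h \<cdot> f = h \<cdot> g\<rbrakk> \<Longrightarrow> \<exists>u. u \<in> hom C Q T \<and> u \<cdot> q = h"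
proof -
  obtain f g where "is_coequalizer C f g q" using assms(1) unfolding is_regular_epi_def by blast
  then obtain X Y' Q' where *: "f \<in> hom C X Y'" "g \<in> hom C X Y'" "q \<in> hom C Y' Q'" "q \<cdot> f = q \<cdot> g"
    "\<And>T h. \<lbrakk>h \<in> hom C Y' T; h \<cdot> f = h \<cdot> g\<rbrakk> \<Longrightarrow> \<exists>u. u \<in> hom C Q' T \<and> u \<cdot> q = h"
    by (elim coequalizerE) blast
  then have "Y' = Y" "Q' = Q" using assms(2) by (auto simp: hom_def)
  then show ?thesis using that * by blast
qed

lemma regular_epi_cancel:
  assumes "is_regular_epi C q" "q \<in> hom C Y Q" "a \<in> hom C Q T" "b \<in> hom C Q T" "a \<cdot> q = b \<cdot> q"
  shows "a = b"
proof -
  obtain f g where "is_coequalizer C f g q" using assms(1) unfolding is_regular_epi_def by blast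
  then obtain Y' Q' where *: "q \<in> hom C Y' Q'"
    "\<And>T a b. \<lbrakk>a \<in> hom C Q' T; b \<in> hom C Q' T; a \<cdot> q = b \<cdot> q\<rbrakk> \<Longrightarrow> a = b"
    by (elim coequalizerE) blast
  then have "Q' = Q" using assms(2) by (auto simp: hom_def)
  then show ?thesis using * assms by blast
qed

text \<open>
  Orthogonality of regular epimorphisms and monomorphisms, in the form in which it is used below:
  to factor \<open>h\<close> through a subobject it is enough to do so after covering its domain.
\<close>

lemma factor_through_mono_locally:
  assumes q: "is_regular_epi C q" "q \<in> hom C S T" and m: "is_mono C m" "m \<in> hom C M Y"
    and h: "h \<in> hom C T Y" and u: "u \<in> hom C S M" and eq: "h \<cdot> q = m \<cdot> u"
  obtains v where "v \<in> hom C T M" "m \<cdot> v = h"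
proof -
  obtain W f g where fg: "f \<in> hom C W S" "g \<in> hom C W S" "q \<cdot> f = q \<cdot> g"
    and ex: "\<And>Z h. \<lbrakk>h \<in> hom C S Z; h \<cdot> f = h \<cdot> g\<rbrakk> \<Longrightarrow> \<exists>u. u \<in> hom C T Z \<and> u \<cdot> q = h"
    using regular_epiE[OF q] by metis
  have "m \<cdot> (u \<cdot> f) = (h \<cdot> q) \<cdot> f" using eq fg u m(2) by (simp add: hom_def)
  also have "\<dots> = (h \<cdot> q) \<cdot> g" using fg h q(2) by (simp add: hom_def)
  also have "\<dots> = m \<cdot> (u \<cdot> g)" using eq fg u m(2) by (simp add: hom_def)
  finally have "u \<cdot> f = u \<cdot> g"
    by (rule mono_cancel[OF m comp_in_hom[OF fg(1) u] comp_in_hom[OF fg(2) u]])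
  then obtain v where v: "v \<in> hom C T M" "v \<cdot> q = u" using ex[OF u] by blast
  have "(m \<cdot> v) \<cdot> q = h \<cdot> q" using v eq m(2) q(2) by (simp add: hom_def)
  then have "m \<cdot> v = h" by (rule regular_epi_cancel[OF q comp_in_hom[OF v(1) m(2)] h])
  then show ?thesis using that v(1) by blast
qed

lemma mono_split_iso:
  assumes m: "is_mono C m" "m \<in> hom C M Y" and v: "v \<in> hom C Y M" "m \<cdot> v = Id C Y"
  shows "is_iso C m"
proof -
  have "m \<cdot> (v \<cdot> m) = m \<cdot> Id C M"
    using m(2) v(1) whisker[OF v(2)] homD[OF m(2)] by (simp add: hom_def)
  then have "v \<cdot> m = Id C M"
    using mono_cancel[OF m comp_in_hom[OF m(2) v(1)] id_in_hom] homD(4)[OF m(2)] by blast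
  then show ?thesis using m(2) v unfolding is_iso_def by blast
qed

lemma isoE:
  assumes "is_iso C f" "f \<in> hom C X Y"
  obtains g where "g \<in> hom C Y X" "g \<cdot> f = Id C X" "f \<cdot> g = Id C Y"
  using assms unfolding is_iso_def by (auto simp: hom_def)

lemma mono_regular_epi_iso:
  assumes m: "is_mono C m" "m \<in> hom C M Y" and u: "u \<in> hom C S M" "is_regular_epi C (m \<cdot> u)"
  shows "is_iso C m"
proof -
  have "Id C Y \<cdot> (m \<cdot> u) = m \<cdot> u" using m(2) u(1) homD[OF m(2)] by (simp add: hom_def)
  then obtain v where "v \<in> hom C Y M" "m \<cdot> v = Id C Y"
    using factor_through_mono_locally[OF u(2) comp_in_hom[OF u(1) m(2)] m id_in_hom u(1)]
      homD(5)[OF m(2)] by blast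
  then show ?thesis by (rule mono_split_iso[OF m])
qed

lemma iso_comp_regular_epi:
  assumes m: "is_iso C m" "m \<in> hom C X Y" and e: "is_regular_epi C e" "e \<in> hom C S X"
  shows "is_regular_epi C (m \<cdot> e)"
proof -
  obtain n where n: "n \<in> hom C Y X" "n \<cdot> m = Id C X" "m \<cdot> n = Id C Y"
    using isoE[OF m] .
  obtain W f g where fg: "f \<in> hom C W S" "g \<in> hom C W S" "e \<cdot> f = e \<cdot> g"
    and ex: "\<And>T h. \<lbrakk>h \<in> hom C S T; h \<cdot> f = h \<cdot> g\<rbrakk> \<Longrightarrow> \<exists>u. u \<in> hom C X T \<and> u \<cdot> e = h"
    using regular_epiE[OF e] by metis
  have "is_coequalizer C f g (m \<cdot> e)"
  proof (rule coequalizerI[OF fg(1,2) comp_in_hom[OF e(2) m(2)]])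
    show "(m \<cdot> e) \<cdot> f = (m \<cdot> e) \<cdot> g" using fg e(2) m(2) by (simp add: hom_def)
  next
    fix T a b assume ab: "a \<in> hom C Y T" "b \<in> hom C Y T" "a \<cdot> (m \<cdot> e) = b \<cdot> (m \<cdot> e)"
    then have "(a \<cdot> m) \<cdot> e = (b \<cdot> m) \<cdot> e" using e(2) m(2) by (simp add: hom_def)
    then have am: "a \<cdot> m = b \<cdot> m"
      using regular_epi_cancel[OF e] comp_in_hom[OF m(2)] ab(1,2) by blast
    have "a = (a \<cdot> m) \<cdot> n" "b = (b \<cdot> m) \<cdot> n" using ab(1,2) m(2) n(1,3) by (simp_all add: hom_def)
    then show "a = b" using am by metis
  next
    fix T h assume h: "h \<in> hom C S T" "h \<cdot> f = h \<cdot> g"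
    then obtain u where u: "u \<in> hom C X T" "u \<cdot> e = h" using ex by blast
    have "(u \<cdot> n) \<cdot> (m \<cdot> e) = h"
      using u n(1) m(2) e(2) whisker[OF n(2)] by (simp add: hom_def)
    then show "\<exists>u. u \<in> hom C Y T \<and> u \<cdot> (m \<cdot> e) = h" using comp_in_hom[OF n(1) u(1)] by blast
  qed
  then show ?thesis unfolding is_regular_epi_def by blast
qed

lemma split_epi_regular:
  assumes "is_split_epi C X Y p s"
  shows "is_regular_epi C p"
proof -
  have p: "p \<in> hom C X Y" and s: "s \<in> hom C Y X" and ps: "p \<cdot> s = Id C Y"
    using assms unfolding is_split_epi_def by blast+
  have X: "X \<in> Ob C" using homD[OF p] by blast
  have "is_coequalizer C (s \<cdot> p) (Id C X) p"
  proof (rule coequalizerI[OF comp_in_hom[OF p s] id_in_hom[OF X] p])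
    show "p \<cdot> (s \<cdot> p) = p \<cdot> Id C X" using p s whisker[OF ps] X by (simp add: hom_def)
  next
    fix T a b assume ab: "a \<in> hom C Y T" "b \<in> hom C Y T" "a \<cdot> p = b \<cdot> p"
    have "(a \<cdot> p) \<cdot> s = a" "(b \<cdot> p) \<cdot> s = b" using ab(1,2) p s ps by (simp_all add: hom_def)
    then show "a = b" using ab(3) by metis
  next
    fix T h assume h: "h \<in> hom C X T" "h \<cdot> (s \<cdot> p) = h \<cdot> Id C X"
    then have "(h \<cdot> s) \<cdot> p = h" using p s X by (simp add: hom_def)
    then show "\<exists>u. u \<in> hom C Y T \<and> u \<cdot> p = h" using comp_in_hom[OF s h(1)] by blast
  qed
  then show ?thesis unfolding is_regular_epi_def by blast
qed

lemma id_regular_epi: "X \<in> Ob C \<Longrightarrow> is_regular_epi C (Id C X)"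
  by (rule split_epi_regular[of X X _ "Id C X"]) (simp add: is_split_epi_def id_in_hom)

lemma pullbackE:
  assumes "is_pullback C f g p q" "f \<in> hom C X Z" "g \<in> hom C Y Z"
  obtains P where "p \<in> hom C P X" "q \<in> hom C P Y" "f \<cdot> p = g \<cdot> q"
    "\<And>T a b. \<lbrakk>a \<in> hom C T X; b \<in> hom C T Y; f \<cdot> a = g \<cdot> b\<rbrakk>
       \<Longrightarrow> \<exists>h. h \<in> hom C T P \<and> p \<cdot> h = a \<and> q \<cdot> h = b"
    "\<And>T h h'. \<lbrakk>h \<in> hom C T P; h' \<in> hom C T P; p \<cdot> h = p \<cdot> h'; q \<cdot> h = q \<cdot> h'\<rbrakk> \<Longrightarrow> h = h'"
proof -
  obtain X' Y' Z' P where "f \<in> hom C X' Z'" "g \<in> hom C Y' Z'"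
    and *: "p \<in> hom C P X'" "q \<in> hom C P Y'" "f \<cdot> p = g \<cdot> q"
    "\<And>T a b. \<lbrakk>a \<in> hom C T X'; b \<in> hom C T Y'; f \<cdot> a = g \<cdot> b\<rbrakk>
       \<Longrightarrow> \<exists>!h. h \<in> hom C T P \<and> p \<cdot> h = a \<and> q \<cdot> h = b"
    using assms(1) unfolding is_pullback_def by blast
  then have eqs: "X' = X" "Y' = Y" using assms(2,3) by (auto simp: hom_def)
  have "h = h'"
    if h: "h \<in> hom C T P" "h' \<in> hom C T P" "p \<cdot> h = p \<cdot> h'" "q \<cdot> h = q \<cdot> h'" for T h h'
  proof -
    have "f \<cdot> (p \<cdot> h) = g \<cdot> (q \<cdot> h)"
      using whisker[OF *(3)] * h assms(2,3) eqs by (simp add: hom_def)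
    then have "\<exists>!k. k \<in> hom C T P \<and> p \<cdot> k = p \<cdot> h \<and> q \<cdot> k = q \<cdot> h"
      using *(4) comp_in_hom[OF h(1) *(1)] comp_in_hom[OF h(1) *(2)] by blast
    then show ?thesis using h by metis
  qed
  then show ?thesis using that[of P] * unfolding eqs by blast
qed

lemma pullbackI:
  assumes "f \<in> hom C X Z" "g \<in> hom C Y Z" "p \<in> hom C P X" "q \<in> hom C P Y" "f \<cdot> p = g \<cdot> q"
    "\<And>T h h'. \<lbrakk>h \<in> hom C T P; h' \<in> hom C T P; p \<cdot> h = p \<cdot> h'; q \<cdot> h = q \<cdot> h'\<rbrakk> \<Longrightarrow> h = h'"
    "\<And>T a b. \<lbrakk>a \<in> hom C T X; b \<in> hom C T Y; f \<cdot> a = g \<cdot> b\<rbrakk>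
       \<Longrightarrow> \<exists>h. h \<in> hom C T P \<and> p \<cdot> h = a \<and> q \<cdot> h = b"
  shows "is_pullback C f g p q"
proof -
  have "\<exists>!h. h \<in> hom C T P \<and> p \<cdot> h = a \<and> q \<cdot> h = b"
    if ab: "a \<in> hom C T X \<and> b \<in> hom C T Y \<and> f \<cdot> a = g \<cdot> b" for T a b
  proof -
    obtain h where "h \<in> hom C T P \<and> p \<cdot> h = a \<and> q \<cdot> h = b" using assms(7) ab by blast
    then show ?thesis using assms(6) by metis
  qed
  then show ?thesis using assms(1-5) unfolding is_pullback_def by blast
qed

lemma binary_coproduct_exists:
  assumes "has_finite_coproducts C" "X \<in> Ob C" "Y \<in> Ob C"
  obtains S \<iota>\<^sub>1 \<iota>\<^sub>2 where "is_binary_coproduct C X Y S \<iota>\<^sub>1 \<iota>\<^sub>2"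
proof -
  define Z where "Z = (\<lambda>i::nat. if i = 0 then X else Y)"
  have "finite {0, 1::nat} \<and> (\<forall>i\<in>{0, 1}. Z i \<in> Ob C)" using assms by (simp add: Z_def)
  then obtain S \<iota> where S: "is_coproduct C {0, 1::nat} Z S \<iota>"
    using assms(1) unfolding has_finite_coproducts_def by blast
  have "\<exists>!h. h \<in> hom C S T \<and> h \<cdot> \<iota> 0 = f \<and> h \<cdot> \<iota> 1 = g"
    if f: "f \<in> hom C X T" and g: "g \<in> hom C Y T" for T f g
  proof -
    define \<tau> where "\<tau> = (\<lambda>i::nat. if i = 0 then f else g)"
    have "\<forall>i\<in>{0, 1}. \<tau> i \<in> hom C (Z i) T" using f g by (simp add: \<tau>_def Z_def)
    then have "\<exists>!h. h \<in> hom C S T \<and> (\<forall>i\<in>{0, 1}. h \<cdot> \<iota> i = \<tau> i)"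
      using S homD(5)[OF f] unfolding is_coproduct_def by blast
    then show ?thesis by (simp add: \<tau>_def)
  qed
  then have "is_binary_coproduct C X Y S (\<iota> 0) (\<iota> 1)"
    using S unfolding is_binary_coproduct_def is_coproduct_def by (simp add: Z_def)
  then show ?thesis by (rule that)
qed

end

section \<open>Zero arrows and kernels\<close>

locale pointed_lex = category +
  assumes pointed: "pointed C"
    and products: "has_finite_products C"
    and equalizers: "has_equalizers C"
begin

lemma binary_product_exists:
  assumes "X \<in> Ob C" "Y \<in> Ob C"
  obtains P p q where "p \<in> hom C P X" "q \<in> hom C P Y"
    "\<And>T a b. \<lbrakk>a \<in> hom C T X; b \<in> hom C T Y\<rbrakk> \<Longrightarrow> \<exists>h. h \<in> hom C T P \<and> p \<cdot> h = a \<and> q \<cdot> h = b"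
    "\<And>T h h'. \<lbrakk>h \<in> hom C T P; h' \<in> hom C T P; p \<cdot> h = p \<cdot> h'; q \<cdot> h = q \<cdot> h'\<rbrakk> \<Longrightarrow> h = h'"
proof -
  define Z where "Z = (\<lambda>i::nat. if i = 0 then X else Y)"
  have "finite {0, 1::nat} \<and> (\<forall>i\<in>{0, 1}. Z i \<in> Ob C)" using assms by (simp add: Z_def)
  then obtain P \<pi> where P: "is_product C {0, 1::nat} Z P \<pi>"
    using products unfolding has_finite_products_def by blast
  have ex: "\<exists>h. h \<in> hom C T P \<and> \<pi> 0 \<cdot> h = a \<and> \<pi> 1 \<cdot> h = b"
    if a: "a \<in> hom C T X" and b: "b \<in> hom C T Y" for T a b
  proof -
    define \<tau> where "\<tau> = (\<lambda>i::nat. if i = 0 then a else b)"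
    have "\<forall>i\<in>{0, 1}. \<tau> i \<in> hom C T (Z i)" using a b by (simp add: \<tau>_def Z_def)
    then have "\<exists>!h. h \<in> hom C T P \<and> (\<forall>i\<in>{0, 1}. \<pi> i \<cdot> h = \<tau> i)"
      using P homD(4)[OF a] unfolding is_product_def by blast
    then show ?thesis by (auto simp: \<tau>_def)
  qed
  have uniq: "h = h'"
    if "h \<in> hom C T P" "h' \<in> hom C T P" "\<pi> 0 \<cdot> h = \<pi> 0 \<cdot> h'" "\<pi> 1 \<cdot> h = \<pi> 1 \<cdot> h'" for T h h'
    using productE[OF P] that by (metis insert_iff singletonD)
  have "\<pi> 0 \<in> hom C P X" "\<pi> 1 \<in> hom C P Y"
    using P unfolding is_product_def by (simp_all add: Z_def)
  then show ?thesis using ex uniq by (rule that)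
qed

lemma pullback_exists:
  assumes f: "f \<in> hom C X Z" and g: "g \<in> hom C Y Z"
  obtains p q where "is_pullback C f g p q"
proof -
  obtain P p q where p: "p \<in> hom C P X" and q: "q \<in> hom C P Y"
    and ex: "\<And>T a b. \<lbrakk>a \<in> hom C T X; b \<in> hom C T Y\<rbrakk>
      \<Longrightarrow> \<exists>h. h \<in> hom C T P \<and> p \<cdot> h = a \<and> q \<cdot> h = b"
    and uniq: "\<And>T h h'. \<lbrakk>h \<in> hom C T P; h' \<in> hom C T P; p \<cdot> h = p \<cdot> h'; q \<cdot> h = q \<cdot> h'\<rbrakk> \<Longrightarrow> h = h'"
    using binary_product_exists[OF homD(4)[OF f] homD(4)[OF g]] by metis
  have fp: "f \<cdot> p \<in> hom C P Z" and gq: "g \<cdot> q \<in> hom C P Z"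
    using comp_in_hom[OF p f] comp_in_hom[OF q g] by blast+
  obtain e where "is_equalizer C (f \<cdot> p) (g \<cdot> q) e"
    using equalizers fp gq unfolding has_equalizers_def by blast
  then obtain X' Y' E where e': "f \<cdot> p \<in> hom C X' Y'" "e \<in> hom C E X'"
      "(f \<cdot> p) \<cdot> e = (g \<cdot> q) \<cdot> e" "is_mono C e"
      "\<And>T h. \<lbrakk>h \<in> hom C T X'; (f \<cdot> p) \<cdot> h = (g \<cdot> q) \<cdot> h\<rbrakk> \<Longrightarrow> \<exists>u. u \<in> hom C T E \<and> e \<cdot> u = h"
    by (elim equalizerE) metis
  moreover have "X' = P" using e'(1) fp by (auto simp: hom_def)
  ultimately have e: "e \<in> hom C E P" "(f \<cdot> p) \<cdot> e = (g \<cdot> q) \<cdot> e" and mono: "is_mono C e"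
    and eex: "\<And>T h. \<lbrakk>h \<in> hom C T P; (f \<cdot> p) \<cdot> h = (g \<cdot> q) \<cdot> h\<rbrakk> \<Longrightarrow> \<exists>u. u \<in> hom C T E \<and> e \<cdot> u = h"
    by auto
  have "is_pullback C f g (p \<cdot> e) (q \<cdot> e)"
  proof (rule pullbackI[OF f g comp_in_hom[OF e(1) p] comp_in_hom[OF e(1) q]])
    show "f \<cdot> (p \<cdot> e) = g \<cdot> (q \<cdot> e)" using e f g p q by (simp add: hom_def)
  next
    fix T h h'
    assume h: "h \<in> hom C T E" "h' \<in> hom C T E"
      and "(p \<cdot> e) \<cdot> h = (p \<cdot> e) \<cdot> h'" "(q \<cdot> e) \<cdot> h = (q \<cdot> e) \<cdot> h'"
    then have "p \<cdot> (e \<cdot> h) = p \<cdot> (e \<cdot> h')" "q \<cdot> (e \<cdot> h) = q \<cdot> (e \<cdot> h')"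
      using e(1) p q by (simp_all add: hom_def)
    then have "e \<cdot> h = e \<cdot> h'"
      using uniq comp_in_hom[OF h(1) e(1)] comp_in_hom[OF h(2) e(1)] by blast
    then show "h = h'" by (rule mono_cancel[OF mono e(1) h])
  next
    fix T a b assume a: "a \<in> hom C T X" and b: "b \<in> hom C T Y" and ab: "f \<cdot> a = g \<cdot> b"
    obtain h where h: "h \<in> hom C T P" "p \<cdot> h = a" "q \<cdot> h = b" using ex[OF a b] by blast
    then have "(f \<cdot> p) \<cdot> h = (g \<cdot> q) \<cdot> h" using f g p q ab by (simp add: hom_def)
    then obtain u where u: "u \<in> hom C T E" "e \<cdot> u = h" using eex h(1) by blast
    then have "(p \<cdot> e) \<cdot> u = a" "(q \<cdot> e) \<cdot> u = b" using h e(1) p q by (simp_all add: hom_def)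
    then show "\<exists>h. h \<in> hom C T E \<and> (p \<cdot> e) \<cdot> h = a \<and> (q \<cdot> e) \<cdot> h = b" using u(1) by blast
  qed
  then show ?thesis by (rule that)
qed

lemma zero_arrowE:
  assumes "is_zero_arrow C z" "z \<in> hom C X Y"
  obtains Z a b where "is_zero_object C Z" "a \<in> hom C X Z" "b \<in> hom C Z Y" "z = b \<cdot> a"
proof -
  obtain X' Y' Z a b
    where *: "is_zero_object C Z" "a \<in> hom C X' Z" "b \<in> hom C Z Y'" "z = b \<cdot> a"
    using assms(1) unfolding is_zero_arrow_def by blast
  have "X' = X" "Y' = Y" using comp_in_hom[OF *(2,3)] *(4) assms(2) by (auto simp: hom_def)
  then show ?thesis using that * by blast
qed

text \<open>
  Nothing depends on which zero object a zero arrow factors through, since there is an arrow between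
  any two of them.
\<close>

lemma zero_arrow_unique:
  assumes "is_zero_arrow C z" "is_zero_arrow C z'" "z \<in> hom C X Y" "z' \<in> hom C X Y"
  shows "z = z'"
proof -
  obtain Z a b where Z: "is_zero_object C Z" "a \<in> hom C X Z" "b \<in> hom C Z Y" "z = b \<cdot> a"
    using zero_arrowE[OF assms(1,3)] .
  obtain Z' a' b'
    where Z': "is_zero_object C Z'" "a' \<in> hom C X Z'" "b' \<in> hom C Z' Y" "z' = b' \<cdot> a'"
    using zero_arrowE[OF assms(2,4)] .
  obtain i where i: "i \<in> hom C Z Z'"
    using Z(1) Z'(1) unfolding is_zero_object_def is_initial_def by blast
  have "b' \<cdot> i = b"
    using Z(1,3) comp_in_hom[OF i Z'(3)] homD(5)[OF assms(3)]
    unfolding is_zero_object_def is_initial_def by blast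
  moreover have "i \<cdot> a = a'"
    using Z'(1,2) comp_in_hom[OF Z(2) i] homD(4)[OF assms(3)]
    unfolding is_zero_object_def is_terminal_def by blast
  moreover have "b' \<cdot> (i \<cdot> a) = (b' \<cdot> i) \<cdot> a" using i Z(2) Z'(3) by (simp add: hom_def)
  ultimately show ?thesis using Z(4) Z'(4) by metis
qed

definition zero where "zero X Y = (SOME z. is_zero_arrow C z \<and> z \<in> hom C X Y)"

lemma zero_arrow_zero:
  assumes "X \<in> Ob C" "Y \<in> Ob C"
  shows "is_zero_arrow C (zero X Y)" "zero X Y \<in> hom C X Y"
proof -
  obtain Z where Z: "is_zero_object C Z" using pointed unfolding pointed_def by blast
  then obtain a b where "a \<in> hom C X Z" "b \<in> hom C Z Y"
    using assms unfolding is_zero_object_def is_initial_def is_terminal_def by blast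
  then have "is_zero_arrow C (b \<cdot> a) \<and> b \<cdot> a \<in> hom C X Y"
    using Z comp_in_hom unfolding is_zero_arrow_def by blast
  then have "is_zero_arrow C (zero X Y) \<and> zero X Y \<in> hom C X Y"
    unfolding zero_def by (rule someI)
  then show "is_zero_arrow C (zero X Y)" "zero X Y \<in> hom C X Y" by blast+
qed

lemma zero_typing [simp]:
  assumes "X \<in> Ob C" "Y \<in> Ob C"
  shows "zero X Y \<in> Ar C" "Dom C (zero X Y) = X" "Cod C (zero X Y) = Y"
  using zero_arrow_zero[OF assms] by (auto simp: hom_def)

lemma eq_zero:
  assumes "is_zero_arrow C z" "z \<in> hom C X Y"
  shows "z = zero X Y"
  using zero_arrow_unique assms zero_arrow_zero homD[OF assms(2)] by blast

lemma comp_zero [simp]: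
  assumes "f \<in> Ar C" "Dom C f = Y" "X \<in> Ob C"
  shows "f \<cdot> zero X Y = zero X (Cod C f)"
proof (rule eq_zero)
  have f: "f \<in> hom C Y (Cod C f)" using assms by (simp add: hom_def)
  have z: "is_zero_arrow C (zero X Y)" "zero X Y \<in> hom C X Y"
    using zero_arrow_zero assms(3) homD[OF f] by blast+
  then show "f \<cdot> zero X Y \<in> hom C X (Cod C f)" using comp_in_hom f by blast
  obtain Z a b where Z: "is_zero_object C Z" "a \<in> hom C X Z" "b \<in> hom C Z Y" "zero X Y = b \<cdot> a"
    using zero_arrowE[OF z] .
  then have "f \<cdot> zero X Y = (f \<cdot> b) \<cdot> a" using f by (simp add: hom_def)
  then show "is_zero_arrow C (f \<cdot> zero X Y)"
    using Z comp_in_hom[OF Z(3) f] unfolding is_zero_arrow_def by blast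
qed

lemma zero_comp [simp]:
  assumes "f \<in> Ar C" "Cod C f = X" "Y \<in> Ob C"
  shows "zero X Y \<cdot> f = zero (Dom C f) Y"
proof (rule eq_zero)
  have f: "f \<in> hom C (Dom C f) X" using assms by (simp add: hom_def)
  have z: "is_zero_arrow C (zero X Y)" "zero X Y \<in> hom C X Y"
    using zero_arrow_zero assms(3) homD[OF f] by blast+
  then show "zero X Y \<cdot> f \<in> hom C (Dom C f) Y" using comp_in_hom f by blast
  obtain Z a b where Z: "is_zero_object C Z" "a \<in> hom C X Z" "b \<in> hom C Z Y" "zero X Y = b \<cdot> a"
    using zero_arrowE[OF z] .
  then have "zero X Y \<cdot> f = b \<cdot> (a \<cdot> f)" using f by (simp add: hom_def)
  then show "is_zero_arrow C (zero X Y \<cdot> f)"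
    using Z comp_in_hom[OF f Z(2)] unfolding is_zero_arrow_def by blast
qed

lemma kernelE:
  assumes "is_kernel_of C f k" "f \<in> hom C X Y" "k \<in> hom C K X"
  obtains "is_mono C k" "f \<cdot> k = zero K Y"
    "\<And>T h. \<lbrakk>h \<in> hom C T X; f \<cdot> h = zero T Y\<rbrakk> \<Longrightarrow> \<exists>u. u \<in> hom C T K \<and> k \<cdot> u = h"
proof -
  obtain z where z: "is_zero_arrow C z" "is_equalizer C f z k"
    using assms(1) unfolding is_kernel_of_def by blast
  then obtain X' Y' K' where *: "f \<in> hom C X' Y'" "z \<in> hom C X' Y'" "k \<in> hom C K' X'"
      "f \<cdot> k = z \<cdot> k" "is_mono C k"
      "\<And>T h. \<lbrakk>h \<in> hom C T X'; f \<cdot> h = z \<cdot> h\<rbrakk> \<Longrightarrow> \<exists>u. u \<in> hom C T K' \<and> k \<cdot> u = h"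
    by (elim equalizerE) metis
  have eqs: "X' = X" "Y' = Y" "K' = K" using *(1,3) assms(2,3) by (auto simp: hom_def)
  have zz: "z = zero X Y" using eq_zero[OF z(1)] *(2) eqs by blast
  have zh: "z \<cdot> h = zero T Y" if "h \<in> hom C T X" for T h
    using that assms(2) homD(5)[OF assms(2)] unfolding zz by (simp add: hom_def)
  show ?thesis
    by (rule that) (use * zh assms(3) in \<open>auto simp: eqs\<close>)
qed

lemma kernelI:
  assumes f: "f \<in> hom C X Y" and k: "k \<in> hom C K X" "is_mono C k" "f \<cdot> k = zero K Y"
    and ex: "\<And>T h. \<lbrakk>h \<in> hom C T X; f \<cdot> h = zero T Y\<rbrakk> \<Longrightarrow> \<exists>u. u \<in> hom C T K \<and> k \<cdot> u = h"
  shows "is_kernel_of C f k"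
proof -
  have z: "is_zero_arrow C (zero X Y)" "zero X Y \<in> hom C X Y"
    using zero_arrow_zero homD[OF f] by blast+
  have zh: "zero X Y \<cdot> h = zero T Y" if "h \<in> hom C T X" for T h
    using that homD(5)[OF f] by (simp add: hom_def)
  have "is_equalizer C f (zero X Y) k"
    by (rule equalizerI[OF f z(2) k(1) _ k(2)]) (simp_all add: zh[OF k(1)] k(3) zh ex)
  then show ?thesis using z(1) unfolding is_kernel_of_def by blast
qed

lemma kernel_exists:
  assumes f: "f \<in> hom C X Y"
  obtains K k where "k \<in> hom C K X" "is_kernel_of C f k"
proof -
  have z: "is_zero_arrow C (zero X Y)" "zero X Y \<in> hom C X Y"
    using zero_arrow_zero homD[OF f] by blast+
  obtain k where k: "is_equalizer C f (zero X Y) k"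
    using equalizers f z(2) unfolding has_equalizers_def by blast
  then obtain X' K where "f \<in> hom C X' Y \<or> X' = Dom C f" "k \<in> hom C K X'"
    by (elim equalizerE) (auto simp: hom_def)
  then have "k \<in> hom C K X" using f by (auto simp: hom_def)
  then show ?thesis using that k z(1) unfolding is_kernel_of_def by blast
qed

lemma cokernelI:
  assumes f: "f \<in> hom C X Y" and q: "q \<in> hom C Y Q" "q \<cdot> f = zero X Q"
    and epi: "\<And>T a b. \<lbrakk>a \<in> hom C Q T; b \<in> hom C Q T; a \<cdot> q = b \<cdot> q\<rbrakk> \<Longrightarrow> a = b"
    and ex: "\<And>T h. \<lbrakk>h \<in> hom C Y T; h \<cdot> f = zero X T\<rbrakk> \<Longrightarrow> \<exists>u. u \<in> hom C Q T \<and> u \<cdot> q = h"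
  shows "is_cokernel C q"
proof -
  have z: "is_zero_arrow C (zero X Y)" "zero X Y \<in> hom C X Y"
    using zero_arrow_zero homD[OF f] by blast+
  have hz: "h \<cdot> zero X Y = zero X T" if "h \<in> hom C Y T" for T h
    using that homD(4)[OF f] by (simp add: hom_def)
  have "is_coequalizer C f (zero X Y) q"
    by (rule coequalizerI[OF f z(2) q(1) _ epi]) (simp_all add: hz[OF q(1)] q(2) hz ex)
  then show ?thesis using z(1) unfolding is_cokernel_def is_cokernel_of_def by blast
qed

lemma cokernel_regular_epi: "is_cokernel C q \<Longrightarrow> is_regular_epi C q"
  unfolding is_cokernel_def is_cokernel_of_def is_regular_epi_def by blast

lemma kernel_pair_exists:
  assumes f: "f \<in> hom C X Y"
  obtains R p q where "is_kernel_pair C f p q" "p \<in> hom C R X" "q \<in> hom C R X" "f \<cdot> p = f \<cdot> q"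
    "\<And>T a b. \<lbrakk>a \<in> hom C T X; b \<in> hom C T X; f \<cdot> a = f \<cdot> b\<rbrakk>
       \<Longrightarrow> \<exists>h. h \<in> hom C T R \<and> p \<cdot> h = a \<and> q \<cdot> h = b"
    "\<And>T h h'. \<lbrakk>h \<in> hom C T R; h' \<in> hom C T R; p \<cdot> h = p \<cdot> h'; q \<cdot> h = q \<cdot> h'\<rbrakk> \<Longrightarrow> h = h'"
proof -
  obtain p q where pq: "is_pullback C f f p q" using pullback_exists[OF f f] .
  show ?thesis
    by (rule pullbackE[OF pq f f], rule that[of p q]) (use pq in \<open>simp_all add: is_kernel_pair_def\<close>)
qed

text \<open>
  The pair of which \<open>q\<close> is the coequalizer factors through the kernel pair of \<open>q\<close>, so \<open>q\<close> is the
  coequalizer of its kernel pair as well.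
\<close>

lemma regular_epi_factors:
  assumes q: "is_regular_epi C q" "q \<in> hom C Y Q" and h: "h \<in> hom C Y T"
    and pr: "p \<in> hom C R Y" "p' \<in> hom C R Y" "h \<cdot> p = h \<cdot> p'"
    and ex: "\<And>T a b. \<lbrakk>a \<in> hom C T Y; b \<in> hom C T Y; q \<cdot> a = q \<cdot> b\<rbrakk>
       \<Longrightarrow> \<exists>h. h \<in> hom C T R \<and> p \<cdot> h = a \<and> p' \<cdot> h = b"
  obtains u where "u \<in> hom C Q T" "u \<cdot> q = h"
proof -
  obtain W f g where fg: "f \<in> hom C W Y" "g \<in> hom C W Y" "q \<cdot> f = q \<cdot> g"
    and qex: "\<And>T h. \<lbrakk>h \<in> hom C Y T; h \<cdot> f = h \<cdot> g\<rbrakk> \<Longrightarrow> \<exists>u. u \<in> hom C Q T \<and> u \<cdot> q = h"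
    using regular_epiE[OF q] by metis
  obtain r where r: "r \<in> hom C W R" "p \<cdot> r = f" "p' \<cdot> r = g" using ex[OF fg] by blast
  have "h \<cdot> (p \<cdot> r) = h \<cdot> (p' \<cdot> r)" using whisker[OF pr(3)] pr(1,2) h r(1) by (simp add: hom_def)
  then have "h \<cdot> f = h \<cdot> g" unfolding r(2,3) .
  then show ?thesis using qex h that by blast
qed

end

section \<open>Split epimorphisms are generated by their kernel and section\<close>

context pointed_lex
begin

definition relation where
  "relation D A B d\<^sub>0 d\<^sub>1 \<longleftrightarrow> d\<^sub>0 \<in> hom C D A \<and> d\<^sub>1 \<in> hom C D B \<and>
     (\<forall>T a b. a \<in> hom C T D \<and> b \<in> hom C T D \<and> d\<^sub>0 \<cdot> a = d\<^sub>0 \<cdot> b \<and> d\<^sub>1 \<cdot> a = d\<^sub>1 \<cdot> b \<longrightarrow> a = b)"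

lemma relationD:
  assumes "relation D A B d\<^sub>0 d\<^sub>1"
  shows "d\<^sub>0 \<in> hom C D A" "d\<^sub>1 \<in> hom C D B"
    "\<lbrakk>a \<in> hom C T D; b \<in> hom C T D; d\<^sub>0 \<cdot> a = d\<^sub>0 \<cdot> b; d\<^sub>1 \<cdot> a = d\<^sub>1 \<cdot> b\<rbrakk> \<Longrightarrow> a = b"
  using assms unfolding relation_def by blast+

text \<open>The subobject of \<open>T\<close> on which the pair \<open>(x, y)\<close> lies in the relation.\<close>

lemma relation_pullback:
  assumes D: "relation D A B d\<^sub>0 d\<^sub>1" and x: "x \<in> hom C T A" and y: "y \<in> hom C T B"
  obtains W w v where "w \<in> hom C W T" "is_mono C w" "v \<in> hom C W D"
    "d\<^sub>0 \<cdot> v = x \<cdot> w" "d\<^sub>1 \<cdot> v = y \<cdot> w"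
    "\<And>S h e. \<lbrakk>h \<in> hom C S T; e \<in> hom C S D; d\<^sub>0 \<cdot> e = x \<cdot> h; d\<^sub>1 \<cdot> e = y \<cdot> h\<rbrakk>
       \<Longrightarrow> \<exists>u. u \<in> hom C S W \<and> w \<cdot> u = h"
proof -
  note d = relationD[OF D]
  obtain P p q where p: "p \<in> hom C P A" and q: "q \<in> hom C P B"
    and Pex: "\<And>T a b. \<lbrakk>a \<in> hom C T A; b \<in> hom C T B\<rbrakk>
      \<Longrightarrow> \<exists>h. h \<in> hom C T P \<and> p \<cdot> h = a \<and> q \<cdot> h = b"
    and Puq: "\<And>T h h'. \<lbrakk>h \<in> hom C T P; h' \<in> hom C T P; p \<cdot> h = p \<cdot> h'; q \<cdot> h = q \<cdot> h'\<rbrakk> \<Longrightarrow> h = h'"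
    using binary_product_exists[OF homD(5)[OF x] homD(5)[OF y]] by metis
  obtain l where l: "l \<in> hom C T P" "p \<cdot> l = x" "q \<cdot> l = y" using Pex[OF x y] by blast
  obtain n where n: "n \<in> hom C D P" "p \<cdot> n = d\<^sub>0" "q \<cdot> n = d\<^sub>1" using Pex[OF d(1,2)] by blast
  have pl: "p \<cdot> (l \<cdot> h) = x \<cdot> h" "q \<cdot> (l \<cdot> h) = y \<cdot> h" if "h \<in> hom C S T" for h S
    using that whisker[OF l(2)] whisker[OF l(3)] l(1) p q by (simp_all add: hom_def)
  have pn: "p \<cdot> (n \<cdot> h) = d\<^sub>0 \<cdot> h" "q \<cdot> (n \<cdot> h) = d\<^sub>1 \<cdot> h" if "h \<in> hom C S D" for h S
    using that whisker[OF n(2)] whisker[OF n(3)] n(1) p q by (simp_all add: hom_def)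
  obtain w v where "is_pullback C l n w v" using pullback_exists[OF l(1) n(1)] .
  then obtain W where w: "w \<in> hom C W T" and v: "v \<in> hom C W D" and wv: "l \<cdot> w = n \<cdot> v"
    and Wex: "\<And>S a b. \<lbrakk>a \<in> hom C S T; b \<in> hom C S D; l \<cdot> a = n \<cdot> b\<rbrakk>
       \<Longrightarrow> \<exists>h. h \<in> hom C S W \<and> w \<cdot> h = a \<and> v \<cdot> h = b"
    and Wuq: "\<And>S h h'. \<lbrakk>h \<in> hom C S W; h' \<in> hom C S W; w \<cdot> h = w \<cdot> h'; v \<cdot> h = v \<cdot> h'\<rbrakk> \<Longrightarrow> h = h'"
    by (rule pullbackE[OF _ l(1) n(1)]) blast
  have dv: "d\<^sub>0 \<cdot> v = x \<cdot> w" "d\<^sub>1 \<cdot> v = y \<cdot> w" using pl[OF w] pn[OF v] wv by metis+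
  have "is_mono C w"
  proof (rule is_monoI[OF w])
    fix S a b assume ab: "a \<in> hom C S W" "b \<in> hom C S W" "w \<cdot> a = w \<cdot> b"
    have "d\<^sub>0 \<cdot> (v \<cdot> a) = x \<cdot> (w \<cdot> a)" "d\<^sub>0 \<cdot> (v \<cdot> b) = x \<cdot> (w \<cdot> b)"
      "d\<^sub>1 \<cdot> (v \<cdot> a) = y \<cdot> (w \<cdot> a)" "d\<^sub>1 \<cdot> (v \<cdot> b) = y \<cdot> (w \<cdot> b)"
      using ab(1,2) whisker[OF dv(1)] whisker[OF dv(2)] d(1,2) v w x y
      by (simp_all add: hom_def)
    then have "v \<cdot> a = v \<cdot> b"
      using d(3) comp_in_hom[OF ab(1) v] comp_in_hom[OF ab(2) v] ab(3) by metis
    then show "a = b" using Wuq ab by blast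
  qed
  moreover have "\<exists>u. u \<in> hom C S W \<and> w \<cdot> u = h"
    if h: "h \<in> hom C S T" and e: "e \<in> hom C S D" and eq: "d\<^sub>0 \<cdot> e = x \<cdot> h" "d\<^sub>1 \<cdot> e = y \<cdot> h"
    for S h e
  proof -
    have "l \<cdot> h = n \<cdot> e"
      by (rule Puq[OF comp_in_hom[OF h l(1)] comp_in_hom[OF e n(1)]])
        (simp_all add: pl[OF h] pn[OF e] eq)
    then show ?thesis using Wex[OF h e] by blast
  qed
  ultimately show ?thesis using that w v dv by blast
qed

end

text \<open>
  The assumption says that a point, i.e. a split epimorphism with a chosen section, has no proper
  subobject containing both its kernel and its section.  It is what protomodularity and axiom A2
  have in common.
\<close>

locale generated_points = pointed_lex +
  assumes generated:
    "\<lbrakk>is_split_epi C X Y p s; k \<in> hom C K X; is_kernel_of C p k; m \<in> hom C M X; is_mono C m;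
      a \<in> hom C K M; m \<cdot> a = k; b \<in> hom C Y M; m \<cdot> b = s\<rbrakk> \<Longrightarrow> is_iso C m"
begin

lemma generated_section:
  assumes "is_split_epi C X Y p s" "k \<in> hom C K X" "is_kernel_of C p k" "m \<in> hom C M X"
    "is_mono C m" "a \<in> hom C K M" "m \<cdot> a = k" "b \<in> hom C Y M" "m \<cdot> b = s"
  obtains c where "c \<in> hom C X M" "m \<cdot> c = Id C X"
  using isoE[OF generated[OF assms] assms(4)] by blast

lemma kernel_section_jointly_epic:
  assumes ps: "is_split_epi C X Y p s" and k: "k \<in> hom C K X" "is_kernel_of C p k"
    and f: "f \<in> hom C X T" and g: "g \<in> hom C X T" and eq: "f \<cdot> k = g \<cdot> k" "f \<cdot> s = g \<cdot> s"
  shows "f = g"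
proof -
  have s: "s \<in> hom C Y X" using ps unfolding is_split_epi_def by blast
  obtain e where "is_equalizer C f g e" using equalizers f g unfolding has_equalizers_def by blast
  then obtain X' Y' E where e': "f \<in> hom C X' Y'" "e \<in> hom C E X'" "f \<cdot> e = g \<cdot> e" "is_mono C e"
    "\<And>T h. \<lbrakk>h \<in> hom C T X'; f \<cdot> h = g \<cdot> h\<rbrakk> \<Longrightarrow> \<exists>u. u \<in> hom C T E \<and> e \<cdot> u = h"
    by (elim equalizerE) metis
  moreover have "X' = X" using e'(1) f by (auto simp: hom_def)
  ultimately have e: "e \<in> hom C E X" "f \<cdot> e = g \<cdot> e" "is_mono C e"
    and ex: "\<And>T h. \<lbrakk>h \<in> hom C T X; f \<cdot> h = g \<cdot> h\<rbrakk> \<Longrightarrow> \<exists>u. u \<in> hom C T E \<and> e \<cdot> u = h"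
    by auto
  obtain a b where "a \<in> hom C K E" "e \<cdot> a = k" "b \<in> hom C Y E" "e \<cdot> b = s"
    using ex[OF k(1) eq(1)] ex[OF s eq(2)] by blast
  then obtain c where c: "c \<in> hom C X E" "e \<cdot> c = Id C X"
    using generated_section[OF ps k e(1,3)] by blast
  have "f = (f \<cdot> e) \<cdot> c" "g = (g \<cdot> e) \<cdot> c" using c e(1) f g by (simp_all add: hom_def)
  then show ?thesis using e(2) by metis
qed

text \<open>
  A reflexive graph is collapsed as soon as the \<open>r\<^sub>2\<close>-image of the kernel of \<open>r\<^sub>1\<close> is: on the
  diagonal the two maps agree anyway.  So relations are controlled by what they identify with zero.
\<close>

lemma coequalizes_reflexive_graph:
  assumes r: "r\<^sub>1 \<in> hom C R X" "r\<^sub>2 \<in> hom C R X" and d: "d \<in> hom C X R"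
    and rd: "r\<^sub>1 \<cdot> d = Id C X" "r\<^sub>2 \<cdot> d = Id C X"
    and k: "k \<in> hom C K R" "is_kernel_of C r\<^sub>1 k"
    and h: "h \<in> hom C X T" "h \<cdot> (r\<^sub>2 \<cdot> k) = zero K T"
  shows "h \<cdot> r\<^sub>1 = h \<cdot> r\<^sub>2"
proof (rule kernel_section_jointly_epic[OF _ k])
  show "is_split_epi C R X r\<^sub>1 d" using r d rd unfolding is_split_epi_def by blast
  show "h \<cdot> r\<^sub>1 \<in> hom C R T" "h \<cdot> r\<^sub>2 \<in> hom C R T" using comp_in_hom r h by blast+
  have "r\<^sub>1 \<cdot> k = zero K X" using kernelE[OF k(2) r(1) k(1)] by blast
  then show "(h \<cdot> r\<^sub>1) \<cdot> k = (h \<cdot> r\<^sub>2) \<cdot> k"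
    using r k(1) h homD(4)[OF k(1)] by (simp add: hom_def)
  show "(h \<cdot> r\<^sub>1) \<cdot> d = (h \<cdot> r\<^sub>2) \<cdot> d" using r d rd h(1) by (simp add: hom_def)
qed

text \<open>
  If \<open>k\<close> is the kernel of the first projection \<open>p\<^sub>1\<close> of the kernel pair of \<open>q\<close>, then \<open>p\<^sub>2 \<cdot> k\<close> is the
  kernel of \<open>q\<close>; a map that kills it coequalizes the kernel pair and so factors through \<open>q\<close>.
\<close>

theorem regular_epi_is_cokernel:
  assumes q: "is_regular_epi C q" "q \<in> hom C Y Q"
  shows "is_cokernel C q"
proof -
  obtain R p\<^sub>1 p\<^sub>2 where p: "p\<^sub>1 \<in> hom C R Y" "p\<^sub>2 \<in> hom C R Y" "q \<cdot> p\<^sub>1 = q \<cdot> p\<^sub>2"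
    and Rex: "\<And>T a b. \<lbrakk>a \<in> hom C T Y; b \<in> hom C T Y; q \<cdot> a = q \<cdot> b\<rbrakk>
       \<Longrightarrow> \<exists>h. h \<in> hom C T R \<and> p\<^sub>1 \<cdot> h = a \<and> p\<^sub>2 \<cdot> h = b"
    using kernel_pair_exists[OF q(2)] by metis
  have Y: "Y \<in> Ob C" using homD[OF q(2)] by blast
  obtain d where d: "d \<in> hom C Y R" "p\<^sub>1 \<cdot> d = Id C Y" "p\<^sub>2 \<cdot> d = Id C Y"
    using Rex[OF id_in_hom[OF Y] id_in_hom[OF Y]] by blast
  obtain K k where k: "k \<in> hom C K R" "is_kernel_of C p\<^sub>1 k" using kernel_exists[OF p(1)] .
  have p1k: "p\<^sub>1 \<cdot> k = zero K Y" using kernelE[OF k(2) p(1) k(1)] by blast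
  show ?thesis
  proof (rule cokernelI[OF comp_in_hom[OF k(1) p(2)] q(2)])
    have "q \<cdot> (p\<^sub>2 \<cdot> k) = q \<cdot> (p\<^sub>1 \<cdot> k)" using whisker[OF p(3)] p(1,2) k(1) q(2) by (simp add: hom_def)
    then show "q \<cdot> (p\<^sub>2 \<cdot> k) = zero K Q"
      using p1k q(2) homD(4)[OF k(1)] by (simp add: hom_def)
  next
    fix T a b assume "a \<in> hom C Q T" "b \<in> hom C Q T" "a \<cdot> q = b \<cdot> q"
    then show "a = b" by (rule regular_epi_cancel[OF q])
  next
    fix T h assume h: "h \<in> hom C Y T" "h \<cdot> (p\<^sub>2 \<cdot> k) = zero K T"
    then have "h \<cdot> p\<^sub>1 = h \<cdot> p\<^sub>2" by (rule coequalizes_reflexive_graph[OF p(1,2) d k])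
    then show "\<exists>u. u \<in> hom C Q T \<and> u \<cdot> q = h"
      using regular_epi_factors[OF q h(1) p(1,2) _ Rex] by blast
  qed
qed

text \<open>
  The identity of \<open>X\<close> kills the trivial kernel of \<open>m\<close>, so it coequalizes the kernel pair of \<open>m\<close>.
\<close>

lemma mono_if_trivial_kernel:
  assumes m: "m \<in> hom C X Y"
    and triv: "\<And>T h. \<lbrakk>h \<in> hom C T X; m \<cdot> h = zero T Y\<rbrakk> \<Longrightarrow> h = zero T X"
  shows "is_mono C m"
proof (rule is_monoI[OF m])
  fix T a b assume ab: "a \<in> hom C T X" "b \<in> hom C T X" "m \<cdot> a = m \<cdot> b"
  obtain R p\<^sub>1 p\<^sub>2 where p: "p\<^sub>1 \<in> hom C R X" "p\<^sub>2 \<in> hom C R X" "m \<cdot> p\<^sub>1 = m \<cdot> p\<^sub>2"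
    and Rex: "\<And>T a b. \<lbrakk>a \<in> hom C T X; b \<in> hom C T X; m \<cdot> a = m \<cdot> b\<rbrakk>
       \<Longrightarrow> \<exists>h. h \<in> hom C T R \<and> p\<^sub>1 \<cdot> h = a \<and> p\<^sub>2 \<cdot> h = b"
    using kernel_pair_exists[OF m] by metis
  have X: "X \<in> Ob C" using homD[OF m] by blast
  obtain d where d: "d \<in> hom C X R" "p\<^sub>1 \<cdot> d = Id C X" "p\<^sub>2 \<cdot> d = Id C X"
    using Rex[OF id_in_hom[OF X] id_in_hom[OF X]] by blast
  obtain K k where k: "k \<in> hom C K R" "is_kernel_of C p\<^sub>1 k" using kernel_exists[OF p(1)] .
  have p1k: "p\<^sub>1 \<cdot> k = zero K X" using kernelE[OF k(2) p(1) k(1)] by blast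
  have "m \<cdot> (p\<^sub>2 \<cdot> k) = m \<cdot> (p\<^sub>1 \<cdot> k)" using whisker[OF p(3)] p(1,2) k(1) m by (simp add: hom_def)
  then have "m \<cdot> (p\<^sub>2 \<cdot> k) = zero K Y" using p1k m homD(4)[OF k(1)] by (simp add: hom_def)
  then have "Id C X \<cdot> (p\<^sub>2 \<cdot> k) = zero K X"
    using triv[OF comp_in_hom[OF k(1) p(2)]] homD(4)[OF k(1)] X by simp
  then have "Id C X \<cdot> p\<^sub>1 = Id C X \<cdot> p\<^sub>2"
    by (rule coequalizes_reflexive_graph[OF p(1,2) d k id_in_hom[OF X]])
  then have "p\<^sub>1 = p\<^sub>2" using p(1,2) by (simp add: hom_def)
  then show "a = b" using Rex[OF ab] by blast
qed

text \<open>
  An element of \<open>Z\<close> killed by \<open>m\<close> lies over zero in \<open>W\<close>, hence in the kernel \<open>L\<close>, on which \<open>m\<close> is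
  injective.  So \<open>m\<close> is a subobject of \<open>X\<close>, and it contains the kernel and the section of \<open>p\<close>.
\<close>

theorem split_short_five: "split_short_five_lemma C"
  unfolding split_short_five_lemma_def
proof (intro allI impI, elim conjE)
  fix Z W q r L i X Y p s K k l m n
  assume qr: "is_split_epi C Z W q r" and i: "i \<in> hom C L Z" "is_kernel_of C q i"
    and ps: "is_split_epi C X Y p s" and k: "k \<in> hom C K X" "is_kernel_of C p k"
    and l: "l \<in> hom C L K" and m: "m \<in> hom C Z X" and n: "n \<in> hom C W Y"
    and mi: "m \<cdot> i = k \<cdot> l" and nq: "n \<cdot> q = p \<cdot> m" and mr: "m \<cdot> r = s \<cdot> n"
    and iso: "is_iso C l" "is_iso C n"
  have q: "q \<in> hom C Z W" and r: "r \<in> hom C W Z" and p: "p \<in> hom C X Y" and s: "s \<in> hom C Y X"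
    using qr ps unfolding is_split_epi_def by blast+
  obtain l' where l': "l' \<in> hom C K L" "l' \<cdot> l = Id C L" "l \<cdot> l' = Id C K" using isoE[OF iso(1) l] .
  obtain n' where n': "n' \<in> hom C Y W" "n' \<cdot> n = Id C W" "n \<cdot> n' = Id C Y" using isoE[OF iso(2) n] .
  have mono: "is_mono C m"
  proof (rule mono_if_trivial_kernel[OF m])
    fix T h assume h: "h \<in> hom C T Z" "m \<cdot> h = zero T X"
    have obs: "T \<in> Ob C" "L \<in> Ob C" "K \<in> Ob C" "X \<in> Ob C" "Y \<in> Ob C" "Z \<in> Ob C" "W \<in> Ob C"
      using homD h(1) l m n by blast+
    have "n \<cdot> (q \<cdot> h) = p \<cdot> (m \<cdot> h)" using whisker[OF nq] q n p m h(1) by (simp add: hom_def)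
    then have nqh: "n \<cdot> (q \<cdot> h) = zero T Y" using h(2) p obs by (simp add: hom_def)
    have "q \<cdot> h = n' \<cdot> (n \<cdot> (q \<cdot> h))" using whisker[OF n'(2)] n' n q h(1) by (simp add: hom_def)
    also have "\<dots> = zero T W" using nqh n'(1) obs by (simp add: hom_def)
    finally obtain y where y: "y \<in> hom C T L" "i \<cdot> y = h"
      using kernelE[OF i(2) q i(1)] h(1) by blast
    have "k \<cdot> (l \<cdot> y) = m \<cdot> (i \<cdot> y)"
      using whisker[OF mi] y(1) l k(1) i(1) m by (simp add: hom_def)
    also have "\<dots> = k \<cdot> zero T K" using y(2) h(2) k(1) obs by (simp add: hom_def)
    finally have ly: "l \<cdot> y = zero T K"
      using kernelE[OF k(2) p k(1)] mono_cancel[OF _ k(1) comp_in_hom[OF y(1) l]]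
        zero_arrow_zero(2)[OF obs(1,3)] by metis
    have "y = l' \<cdot> (l \<cdot> y)" using whisker[OF l'(2)] l' l y(1) by (simp add: hom_def)
    then have "y = zero T L" using ly l'(1) obs by (simp add: hom_def)
    then show "h = zero T Z" using y(2) i(1) obs by (simp add: hom_def)
  qed
  show "is_iso C m"
  proof (rule generated[OF ps k m mono comp_in_hom[OF l'(1) i(1)] _ comp_in_hom[OF n'(1) r]])
    show "m \<cdot> (i \<cdot> l') = k" using whisker[OF mi] m i(1) l l' k(1) by (simp add: hom_def)
    show "m \<cdot> (r \<cdot> n') = s" using whisker[OF mr] m r n n' s by (simp add: hom_def)
  qed
qed

theorem protomodular: "protomodular C"
  unfolding protomodular_def
proof (intro conjI allI impI)
  show "pointed C" by (rule pointed)
  show "split_short_five_lemma C" by (rule split_short_five)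
  fix X Y W p s g assume "is_split_epi C X Y p s \<and> g \<in> hom C W Y"
  then have "p \<in> hom C X Y" "g \<in> hom C W Y" unfolding is_split_epi_def by blast+
  then show "\<exists>p\<^sub>1 p\<^sub>2. is_pullback C p g p\<^sub>1 p\<^sub>2" using pullback_exists by blast
qed

text \<open>
  Consider the object \<open>T\<close> of triples \<open>(a, b), (a', b), (a', b')\<close> in \<open>D\<close>, as a point over the object
  of pairs \<open>(a, b), (a', b)\<close>; its section repeats the second entry.  The triples with
  \<open>(a, b') \<in> D\<close> contain the section, where \<open>b' = b\<close>, and the kernel, where \<open>a = a' = 0\<close>.
\<close>

theorem difunctional:
  assumes D: "relation D A B d\<^sub>0 d\<^sub>1"
    and \<alpha>: "\<alpha> \<in> hom C Q D" and \<beta>: "\<beta> \<in> hom C Q D" and \<gamma>: "\<gamma> \<in> hom C Q D"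
    and \<alpha>\<beta>: "d\<^sub>1 \<cdot> \<alpha> = d\<^sub>1 \<cdot> \<beta>" and \<beta>\<gamma>: "d\<^sub>0 \<cdot> \<beta> = d\<^sub>0 \<cdot> \<gamma>"
  obtains \<delta> where "\<delta> \<in> hom C Q D" "d\<^sub>0 \<cdot> \<delta> = d\<^sub>0 \<cdot> \<alpha>" "d\<^sub>1 \<cdot> \<delta> = d\<^sub>1 \<cdot> \<gamma>"
proof -
  note d = relationD[OF D]
  obtain U u\<^sub>1 u\<^sub>2 where u: "u\<^sub>1 \<in> hom C U D" "u\<^sub>2 \<in> hom C U D" "d\<^sub>1 \<cdot> u\<^sub>1 = d\<^sub>1 \<cdot> u\<^sub>2"
    and Uex: "\<And>T a b. \<lbrakk>a \<in> hom C T D; b \<in> hom C T D; d\<^sub>1 \<cdot> a = d\<^sub>1 \<cdot> b\<rbrakk>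
       \<Longrightarrow> \<exists>h. h \<in> hom C T U \<and> u\<^sub>1 \<cdot> h = a \<and> u\<^sub>2 \<cdot> h = b"
    using kernel_pair_exists[OF d(2)] by metis
  have du: "d\<^sub>0 \<cdot> u\<^sub>2 \<in> hom C U A" using comp_in_hom[OF u(2) d(1)] .
  obtain t\<^sub>1 t\<^sub>2 where "is_pullback C (d\<^sub>0 \<cdot> u\<^sub>2) d\<^sub>0 t\<^sub>1 t\<^sub>2" using pullback_exists[OF du d(1)] .
  then obtain T where t: "t\<^sub>1 \<in> hom C T U" "t\<^sub>2 \<in> hom C T D" "(d\<^sub>0 \<cdot> u\<^sub>2) \<cdot> t\<^sub>1 = d\<^sub>0 \<cdot> t\<^sub>2"
    and Tex: "\<And>S a b. \<lbrakk>a \<in> hom C S U; b \<in> hom C S D; (d\<^sub>0 \<cdot> u\<^sub>2) \<cdot> a = d\<^sub>0 \<cdot> b\<rbrakk>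
       \<Longrightarrow> \<exists>h. h \<in> hom C S T \<and> t\<^sub>1 \<cdot> h = a \<and> t\<^sub>2 \<cdot> h = b"
    by (rule pullbackE[OF _ du d(1)]) blast
  have obs: "U \<in> Ob C" "D \<in> Ob C" "A \<in> Ob C" using homD u(1) d(1) by blast+
  have "(d\<^sub>0 \<cdot> u\<^sub>2) \<cdot> Id C U = d\<^sub>0 \<cdot> u\<^sub>2" using comp_id[OF du] .
  then obtain s where s: "s \<in> hom C U T" "t\<^sub>1 \<cdot> s = Id C U" "t\<^sub>2 \<cdot> s = u\<^sub>2"
    using Tex[OF id_in_hom[OF obs(1)] u(2)] by blast
  have split: "is_split_epi C T U t\<^sub>1 s" using t(1) s unfolding is_split_epi_def by blast
  obtain K \<kappa> where \<kappa>: "\<kappa> \<in> hom C K T" "is_kernel_of C t\<^sub>1 \<kappa>" using kernel_exists[OF t(1)] .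
  have t1\<kappa>: "t\<^sub>1 \<cdot> \<kappa> = zero K U" using kernelE[OF \<kappa>(2) t(1) \<kappa>(1)] by blast
  have K: "K \<in> Ob C" using homD[OF \<kappa>(1)] by blast
  have x: "d\<^sub>0 \<cdot> (u\<^sub>1 \<cdot> t\<^sub>1) \<in> hom C T A" and y: "d\<^sub>1 \<cdot> t\<^sub>2 \<in> hom C T B"
    using comp_in_hom t u d(1,2) by blast+
  obtain W w v where w: "w \<in> hom C W T" "is_mono C w" and v: "v \<in> hom C W D"
    and dv: "d\<^sub>0 \<cdot> v = (d\<^sub>0 \<cdot> (u\<^sub>1 \<cdot> t\<^sub>1)) \<cdot> w" "d\<^sub>1 \<cdot> v = (d\<^sub>1 \<cdot> t\<^sub>2) \<cdot> w"
    and Wex: "\<And>S h e. \<lbrakk>h \<in> hom C S T; e \<in> hom C S D; d\<^sub>0 \<cdot> e = (d\<^sub>0 \<cdot> (u\<^sub>1 \<cdot> t\<^sub>1)) \<cdot> h;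
        d\<^sub>1 \<cdot> e = (d\<^sub>1 \<cdot> t\<^sub>2) \<cdot> h\<rbrakk> \<Longrightarrow> \<exists>u. u \<in> hom C S W \<and> w \<cdot> u = h"
    using relation_pullback[OF D x y] by metis
  obtain a where a: "a \<in> hom C K W" "w \<cdot> a = \<kappa>"
  proof -
    have "d\<^sub>0 \<cdot> (t\<^sub>2 \<cdot> \<kappa>) = ((d\<^sub>0 \<cdot> u\<^sub>2) \<cdot> t\<^sub>1) \<cdot> \<kappa>" using t \<kappa>(1) d(1) u(2) by (simp add: hom_def)
    also have "\<dots> = zero K A" using t(1) \<kappa>(1) d(1) u(2) t1\<kappa> K obs by (simp add: hom_def)
    also have "zero K A = (d\<^sub>0 \<cdot> (u\<^sub>1 \<cdot> t\<^sub>1)) \<cdot> \<kappa>"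
      using t(1) \<kappa>(1) d(1) u(1) t1\<kappa> K obs by (simp add: hom_def)
    finally have "d\<^sub>0 \<cdot> (t\<^sub>2 \<cdot> \<kappa>) = (d\<^sub>0 \<cdot> (u\<^sub>1 \<cdot> t\<^sub>1)) \<cdot> \<kappa>" .
    moreover have "d\<^sub>1 \<cdot> (t\<^sub>2 \<cdot> \<kappa>) = (d\<^sub>1 \<cdot> t\<^sub>2) \<cdot> \<kappa>" using t(2) \<kappa>(1) d(2) by (simp add: hom_def)
    ultimately show ?thesis using that Wex[OF \<kappa>(1) comp_in_hom[OF \<kappa>(1) t(2)]] by blast
  qed
  obtain b where b: "b \<in> hom C U W" "w \<cdot> b = s"
  proof -
    have "d\<^sub>0 \<cdot> u\<^sub>1 = (d\<^sub>0 \<cdot> (u\<^sub>1 \<cdot> t\<^sub>1)) \<cdot> s" using t(1) s d(1) u(1) by (simp add: hom_def)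
    moreover have "d\<^sub>1 \<cdot> u\<^sub>1 = (d\<^sub>1 \<cdot> t\<^sub>2) \<cdot> s" using t(2) s d(2) u by (simp add: hom_def)
    ultimately show ?thesis using that Wex[OF s(1) u(1)] by blast
  qed
  obtain c where c: "c \<in> hom C T W" "w \<cdot> c = Id C T"
    using generated_section[OF split \<kappa> w a b] .
  obtain e where e: "e \<in> hom C Q U" "u\<^sub>1 \<cdot> e = \<alpha>" "u\<^sub>2 \<cdot> e = \<beta>" using Uex[OF \<alpha> \<beta> \<alpha>\<beta>] by blast
  have "(d\<^sub>0 \<cdot> u\<^sub>2) \<cdot> e = d\<^sub>0 \<cdot> \<gamma>" using e \<beta>\<gamma> d(1) u(2) by (simp add: hom_def)
  then obtain f where f: "f \<in> hom C Q T" "t\<^sub>1 \<cdot> f = e" "t\<^sub>2 \<cdot> f = \<gamma>" using Tex[OF e(1) \<gamma>] by blast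
  have "d\<^sub>0 \<cdot> (v \<cdot> (c \<cdot> f)) = d\<^sub>0 \<cdot> \<alpha>"
    using whisker[OF dv(1)] whisker[OF c(2)] d(1) v w(1) c(1) f u(1) t(1) e(2)
    by (simp add: hom_def)
  moreover have "d\<^sub>1 \<cdot> (v \<cdot> (c \<cdot> f)) = d\<^sub>1 \<cdot> \<gamma>"
    using whisker[OF dv(2)] whisker[OF c(2)] d(2) v w(1) c(1) f t(2)
    by (simp add: hom_def)
  moreover have "v \<cdot> (c \<cdot> f) \<in> hom C Q D" using comp_in_hom f(1) c(1) v by blast
  ultimately show ?thesis by (rule that[rotated])
qed

theorem reflexive_relation_is_equivalence:
  assumes R: "relation R X X r\<^sub>1 r\<^sub>2" and d: "d \<in> hom C X R" "r\<^sub>1 \<cdot> d = Id C X" "r\<^sub>2 \<cdot> d = Id C X"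
  shows "is_equivalence_relation C r\<^sub>1 r\<^sub>2"
proof -
  note r = relationD[OF R]
  have Rob: "R \<in> Ob C" using homD[OF r(1)] by blast
  have rd: "r\<^sub>1 \<cdot> (d \<cdot> h) = h" "r\<^sub>2 \<cdot> (d \<cdot> h) = h" if "h \<in> hom C T X" for h T
    using that whisker[OF d(2)] whisker[OF d(3)] r(1,2) d(1) by (simp_all add: hom_def)
  have d1: "d \<cdot> r\<^sub>1 \<in> hom C R R" and d2: "d \<cdot> r\<^sub>2 \<in> hom C R R" using comp_in_hom r(1,2) d(1) by blast+
  \<comment> \<open>from \<open>x R y\<close>: apply difunctionality to \<open>y R y\<close>, \<open>x R y\<close>, \<open>x R x\<close>\<close>
  obtain \<sigma> where \<sigma>: "\<sigma> \<in> hom C R R" "r\<^sub>1 \<cdot> \<sigma> = r\<^sub>2" "r\<^sub>2 \<cdot> \<sigma> = r\<^sub>1"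
  proof (rule difunctional[OF R d2 id_in_hom[OF Rob] d1])
    show "r\<^sub>2 \<cdot> (d \<cdot> r\<^sub>2) = r\<^sub>2 \<cdot> Id C R" "r\<^sub>1 \<cdot> Id C R = r\<^sub>1 \<cdot> (d \<cdot> r\<^sub>1)"
      using rd[OF r(1)] rd[OF r(2)] comp_id r(1,2) by metis+
  next
    fix \<delta> assume "\<delta> \<in> hom C R R" "r\<^sub>1 \<cdot> \<delta> = r\<^sub>1 \<cdot> (d \<cdot> r\<^sub>2)" "r\<^sub>2 \<cdot> \<delta> = r\<^sub>2 \<cdot> (d \<cdot> r\<^sub>1)"
    then show ?thesis using that rd[OF r(1)] rd[OF r(2)] by metis
  qed
  obtain p\<^sub>1 p\<^sub>2 where pb: "is_pullback C r\<^sub>2 r\<^sub>1 p\<^sub>1 p\<^sub>2" using pullback_exists[OF r(2,1)] .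
  then obtain P where p: "p\<^sub>1 \<in> hom C P R" "p\<^sub>2 \<in> hom C P R" "r\<^sub>2 \<cdot> p\<^sub>1 = r\<^sub>1 \<cdot> p\<^sub>2"
    by (rule pullbackE[OF _ r(2,1)]) blast
  have yP: "r\<^sub>1 \<cdot> p\<^sub>2 \<in> hom C P X" using comp_in_hom[OF p(2) r(1)] .
  \<comment> \<open>from \<open>x R y\<close> and \<open>y R z\<close>: apply difunctionality to \<open>x R y\<close>, \<open>y R y\<close>, \<open>y R z\<close>\<close>
  obtain t where t: "t \<in> hom C P R" "r\<^sub>1 \<cdot> t = r\<^sub>1 \<cdot> p\<^sub>1" "r\<^sub>2 \<cdot> t = r\<^sub>2 \<cdot> p\<^sub>2"
  proof (rule difunctional[OF R p(1) comp_in_hom[OF yP d(1)] p(2)])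
    show "r\<^sub>2 \<cdot> p\<^sub>1 = r\<^sub>2 \<cdot> (d \<cdot> (r\<^sub>1 \<cdot> p\<^sub>2))" "r\<^sub>1 \<cdot> (d \<cdot> (r\<^sub>1 \<cdot> p\<^sub>2)) = r\<^sub>1 \<cdot> p\<^sub>2"
      using rd[OF yP] p(3) by simp_all
  qed blast
  show ?thesis
    unfolding is_equivalence_relation_def
    using r(1,2) R[unfolded relation_def] d \<sigma> p(1,2) pb t by blast
qed

end

section \<open>Images and covers in a regular category\<close>

context pointed_lex
begin

lemma cover:
  assumes "regular C" and q: "is_regular_epi C q" "q \<in> hom C X Y" and h: "h \<in> hom C T Y"
  obtains S t s where "t \<in> hom C S T" "is_regular_epi C t" "s \<in> hom C S X" "q \<cdot> s = h \<cdot> t"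
proof -
  obtain s t where pb: "is_pullback C q h s t" using pullback_exists[OF q(2) h] .
  then have "is_regular_epi C t" using assms(1) q(1) unfolding regular_def by blast
  moreover obtain S where "s \<in> hom C S X" "t \<in> hom C S T" "q \<cdot> s = h \<cdot> t"
    using pb by (rule pullbackE[OF _ q(2) h]) blast
  ultimately show ?thesis using that by blast
qed

text \<open>
  The first factor is the coequalizer of the kernel pair of \<open>f\<close>.  Two elements of its codomain
  with the same image in \<open>Y\<close> lift, on a cover, to a pair in that kernel pair.
\<close>

lemma image_factorization:
  assumes reg: "regular C" and f: "f \<in> hom C X Y"
  obtains I e m where "e \<in> hom C X I" "m \<in> hom C I Y" "is_regular_epi C e" "is_mono C m" "f = m \<cdot> e"
proof -
  obtain R p\<^sub>1 p\<^sub>2 where kp: "is_kernel_pair C f p\<^sub>1 p\<^sub>2"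
    and p: "p\<^sub>1 \<in> hom C R X" "p\<^sub>2 \<in> hom C R X" "f \<cdot> p\<^sub>1 = f \<cdot> p\<^sub>2"
    and Rex: "\<And>T a b. \<lbrakk>a \<in> hom C T X; b \<in> hom C T X; f \<cdot> a = f \<cdot> b\<rbrakk>
       \<Longrightarrow> \<exists>h. h \<in> hom C T R \<and> p\<^sub>1 \<cdot> h = a \<and> p\<^sub>2 \<cdot> h = b"
    using kernel_pair_exists[OF f] by metis
  obtain e where coeq: "is_coequalizer C p\<^sub>1 p\<^sub>2 e" using kp reg unfolding regular_def by blast
  then obtain R' X' I where e': "p\<^sub>1 \<in> hom C R' X'" "e \<in> hom C X' I" "e \<cdot> p\<^sub>1 = e \<cdot> p\<^sub>2"
    "\<And>T h. \<lbrakk>h \<in> hom C X' T; h \<cdot> p\<^sub>1 = h \<cdot> p\<^sub>2\<rbrakk> \<Longrightarrow> \<exists>u. u \<in> hom C I T \<and> u \<cdot> e = h"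
    by (elim coequalizerE) metis
  have "X' = X" using e'(1) p(1) by (auto simp: hom_def)
  then have e: "e \<in> hom C X I" "e \<cdot> p\<^sub>1 = e \<cdot> p\<^sub>2"
    and Iex: "\<And>T h. \<lbrakk>h \<in> hom C X T; h \<cdot> p\<^sub>1 = h \<cdot> p\<^sub>2\<rbrakk> \<Longrightarrow> \<exists>u. u \<in> hom C I T \<and> u \<cdot> e = h"
    using e' by auto
  have epi: "is_regular_epi C e" using coeq unfolding is_regular_epi_def by blast
  obtain m where m: "m \<in> hom C I Y" "m \<cdot> e = f" using Iex[OF f p(3)] by blast
  have "is_mono C m"
  proof (rule is_monoI[OF m(1)])
    fix T a b assume a: "a \<in> hom C T I" and b: "b \<in> hom C T I" and ab: "m \<cdot> a = m \<cdot> b"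
    obtain S t x where t: "t \<in> hom C S T" "is_regular_epi C t" and x: "x \<in> hom C S X" "e \<cdot> x = a \<cdot> t"
      using cover[OF reg epi e(1) a] .
    have bt: "b \<cdot> t \<in> hom C S I" using comp_in_hom[OF t(1) b] .
    obtain S' t' y where t': "t' \<in> hom C S' S" "is_regular_epi C t'"
      and y: "y \<in> hom C S' X" "e \<cdot> y = (b \<cdot> t) \<cdot> t'"
      using cover[OF reg epi e(1) bt] .
    have xt: "x \<cdot> t' \<in> hom C S' X" using comp_in_hom[OF t'(1) x(1)] .
    have "f \<cdot> (x \<cdot> t') = m \<cdot> ((e \<cdot> x) \<cdot> t')" using m(1) e(1) x(1) t'(1) by (simp add: hom_def flip: m(2))
    also have "\<dots> = (m \<cdot> a) \<cdot> (t \<cdot> t')" unfolding x(2) using m(1) a t(1) t'(1) by (simp add: hom_def)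
    also have "\<dots> = m \<cdot> ((b \<cdot> t) \<cdot> t')" unfolding ab using m(1) b t(1) t'(1) by (simp add: hom_def)
    also have "\<dots> = f \<cdot> y" unfolding y(2)[symmetric] m(2)[symmetric] using y(1) m(1) e(1) by (simp add: hom_def)
    finally obtain r where r: "r \<in> hom C S' R" "p\<^sub>1 \<cdot> r = x \<cdot> t'" "p\<^sub>2 \<cdot> r = y"
      using Rex[OF xt y(1)] by blast
    have "(a \<cdot> t) \<cdot> t' = e \<cdot> (x \<cdot> t')" using e(1) x(1) t'(1) by (simp add: hom_def flip: x(2))
    also have "\<dots> = (e \<cdot> p\<^sub>1) \<cdot> r" using e(1) p(1) r(1) by (simp add: hom_def r(2))
    also have "\<dots> = (b \<cdot> t) \<cdot> t'" unfolding e(2) using e(1) p(2) r(1) y(2) by (simp add: hom_def r(3))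
    finally have "a \<cdot> t = b \<cdot> t"
      by (rule regular_epi_cancel[OF t'(2,1) comp_in_hom[OF t(1) a] bt])
    then show "a = b" by (rule regular_epi_cancel[OF t(2,1) a b])
  qed
  then show ?thesis using that e(1) m epi by blast
qed

lemma relation_image:
  assumes reg: "regular C" and f: "f \<in> hom C X A" and g: "g \<in> hom C X B"
  obtains D d\<^sub>0 d\<^sub>1 e where "relation D A B d\<^sub>0 d\<^sub>1" "e \<in> hom C X D" "is_regular_epi C e"
    "d\<^sub>0 \<cdot> e = f" "d\<^sub>1 \<cdot> e = g"
proof -
  obtain P p q where p: "p \<in> hom C P A" and q: "q \<in> hom C P B"
    and Pex: "\<And>T a b. \<lbrakk>a \<in> hom C T A; b \<in> hom C T B\<rbrakk>
      \<Longrightarrow> \<exists>h. h \<in> hom C T P \<and> p \<cdot> h = a \<and> q \<cdot> h = b"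
    and Puq: "\<And>T h h'. \<lbrakk>h \<in> hom C T P; h' \<in> hom C T P; p \<cdot> h = p \<cdot> h'; q \<cdot> h = q \<cdot> h'\<rbrakk> \<Longrightarrow> h = h'"
    using binary_product_exists[OF homD(5)[OF f] homD(5)[OF g]] by metis
  obtain h where h: "h \<in> hom C X P" "p \<cdot> h = f" "q \<cdot> h = g" using Pex[OF f g] by blast
  obtain D e m where e: "e \<in> hom C X D" "is_regular_epi C e"
    and m: "m \<in> hom C D P" "is_mono C m" and hme: "h = m \<cdot> e"
    using image_factorization[OF reg h(1)] .
  have "relation D A B (p \<cdot> m) (q \<cdot> m)"
    unfolding relation_def
  proof (intro conjI allI impI comp_in_hom[OF m(1) p] comp_in_hom[OF m(1) q], elim conjE)
    fix T a b assume ab: "a \<in> hom C T D" "b \<in> hom C T D"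
      and "(p \<cdot> m) \<cdot> a = (p \<cdot> m) \<cdot> b" "(q \<cdot> m) \<cdot> a = (q \<cdot> m) \<cdot> b"
    then have "p \<cdot> (m \<cdot> a) = p \<cdot> (m \<cdot> b)" "q \<cdot> (m \<cdot> a) = q \<cdot> (m \<cdot> b)"
      using m(1) p q by (simp_all add: hom_def)
    then have "m \<cdot> a = m \<cdot> b"
      using Puq comp_in_hom[OF ab(1) m(1)] comp_in_hom[OF ab(2) m(1)] by blast
    then show "a = b" by (rule mono_cancel[OF m(2,1) ab])
  qed
  moreover have "(p \<cdot> m) \<cdot> e = f" "(q \<cdot> m) \<cdot> e = g"
    using h(2,3) m(1) e(1) p q unfolding hme by (simp_all add: hom_def)
  ultimately show ?thesis using that e by blast
qed

text \<open>
  Membership in a relation may be checked on a cover: the subobject of \<open>T\<close> on which it holds is one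
  through which the cover factors, hence everything.
\<close>

lemma relation_locally:
  assumes D: "relation D A B d\<^sub>0 d\<^sub>1" and x: "x \<in> hom C T A" and y: "y \<in> hom C T B"
    and t: "is_regular_epi C t" "t \<in> hom C S T"
    and u: "u \<in> hom C S D" "d\<^sub>0 \<cdot> u = x \<cdot> t" "d\<^sub>1 \<cdot> u = y \<cdot> t"
  obtains v where "v \<in> hom C T D" "d\<^sub>0 \<cdot> v = x" "d\<^sub>1 \<cdot> v = y"
proof -
  note d = relationD[OF D]
  obtain W w v where w: "w \<in> hom C W T" "is_mono C w" and v: "v \<in> hom C W D"
    and dv: "d\<^sub>0 \<cdot> v = x \<cdot> w" "d\<^sub>1 \<cdot> v = y \<cdot> w"
    and Wex: "\<And>S h e. \<lbrakk>h \<in> hom C S T; e \<in> hom C S D; d\<^sub>0 \<cdot> e = x \<cdot> h; d\<^sub>1 \<cdot> e = y \<cdot> h\<rbrakk>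
       \<Longrightarrow> \<exists>u. u \<in> hom C S W \<and> w \<cdot> u = h"
    using relation_pullback[OF D x y] by metis
  obtain u' where u': "u' \<in> hom C S W" "w \<cdot> u' = t" using Wex[OF t(2) u] by blast
  then have "is_iso C w" using mono_regular_epi_iso[OF w(2,1) u'(1)] t(1) by simp
  then obtain c where c: "c \<in> hom C T W" "w \<cdot> c = Id C T" using isoE w(1) by blast
  have "d\<^sub>0 \<cdot> (v \<cdot> c) = x" "d\<^sub>1 \<cdot> (v \<cdot> c) = y"
    using whisker[OF dv(1)] whisker[OF dv(2)] c v w(1) d(1,2) x y by (simp_all add: hom_def)
  then show ?thesis using that comp_in_hom[OF c(1) v] by blast
qed

section \<open>Generation of points from A2 or from protomodularity\<close>

text \<open>The cokernel \<open>\<langle>k, s\<rangle>\<close> factors through any monomorphism through which \<open>k\<close> and \<open>s\<close> do.\<close>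

theorem generated_points_from_A2:
  assumes "has_finite_coproducts C" "axiom_A2 C"
  shows "generated_points C"
proof
  fix X Y p s K k M m a b
  assume ps: "is_split_epi C X Y p s" and k: "k \<in> hom C K X" "is_kernel_of C p k"
    and m: "m \<in> hom C M X" "is_mono C m"
    and a: "a \<in> hom C K M" "m \<cdot> a = k" and b: "b \<in> hom C Y M" "m \<cdot> b = s"
  obtain S \<iota>\<^sub>1 \<iota>\<^sub>2 where S: "is_binary_coproduct C K Y S \<iota>\<^sub>1 \<iota>\<^sub>2"
    using binary_coproduct_exists[OF assms(1) homD(4)[OF a(1)] homD(4)[OF b(1)]] .
  then have \<iota>: "\<iota>\<^sub>1 \<in> hom C K S" "\<iota>\<^sub>2 \<in> hom C Y S" unfolding is_binary_coproduct_def by blast+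
  obtain c where c: "c \<in> hom C S M" "c \<cdot> \<iota>\<^sub>1 = a" "c \<cdot> \<iota>\<^sub>2 = b"
    using S a(1) b(1) unfolding is_binary_coproduct_def by blast
  have mc: "m \<cdot> c \<in> hom C S X" "(m \<cdot> c) \<cdot> \<iota>\<^sub>1 = k" "(m \<cdot> c) \<cdot> \<iota>\<^sub>2 = s"
    using c a b m(1) \<iota> by (simp_all add: hom_def)
  then have "is_cokernel C (m \<cdot> c)" using assms(2) ps k S unfolding axiom_A2_def by blast
  then show "is_iso C m"
    using mono_regular_epi_iso[OF m(2,1) c(1)] cokernel_regular_epi by blast
qed

text \<open>
  A subobject \<open>m\<close> containing kernel and section of \<open>p\<close> makes \<open>p \<cdot> m\<close> a point with the same kernel
  and the same base, to which the split short five lemma applies.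
\<close>

theorem generated_points_from_protomodular:
  assumes "protomodular C"
  shows "generated_points C"
proof
  fix X Y p s K k M m a b
  assume ps: "is_split_epi C X Y p s" and k: "k \<in> hom C K X" "is_kernel_of C p k"
    and m: "m \<in> hom C M X" "is_mono C m"
    and a: "a \<in> hom C K M" "m \<cdot> a = k" and b: "b \<in> hom C Y M" "m \<cdot> b = s"
  have p: "p \<in> hom C X Y" and s: "s \<in> hom C Y X" and id: "p \<cdot> s = Id C Y"
    using ps unfolding is_split_epi_def by blast+
  have obs: "X \<in> Ob C" "Y \<in> Ob C" "K \<in> Ob C" "M \<in> Ob C" using homD p a(1) by blast+
  have iso: "is_iso C (Id C Z)" if "Z \<in> Ob C" for Z
    using id_in_hom[OF that] comp_id unfolding is_iso_def by blast
  have pm: "p \<cdot> m \<in> hom C M Y" using comp_in_hom[OF m(1) p] .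
  have point: "is_split_epi C M Y (p \<cdot> m) b"
    using pm b id p m(1) unfolding is_split_epi_def by (simp add: hom_def)
  have kmono: "is_mono C k" and pk: "p \<cdot> k = zero K Y"
    and kex: "\<And>T h. \<lbrakk>h \<in> hom C T X; p \<cdot> h = zero T Y\<rbrakk> \<Longrightarrow> \<exists>u. u \<in> hom C T K \<and> k \<cdot> u = h"
    using kernelE[OF k(2) p k(1)] by blast+
  have kernel: "is_kernel_of C (p \<cdot> m) a"
  proof (rule kernelI[OF pm a(1)])
    show "is_mono C a"
    proof (rule is_monoI[OF a(1)])
      fix T x y assume xy: "x \<in> hom C T K" "y \<in> hom C T K" "a \<cdot> x = a \<cdot> y"
      have "k \<cdot> x = m \<cdot> (a \<cdot> x)" "k \<cdot> y = m \<cdot> (a \<cdot> y)"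
        using xy(1,2) a(1) m(1) by (simp_all add: hom_def flip: a(2))
      then show "x = y" using mono_cancel[OF kmono k(1) xy(1,2)] xy(3) by simp
    qed
    show "(p \<cdot> m) \<cdot> a = zero K Y" using pk a p m(1) by (simp add: hom_def)
    fix T h assume h: "h \<in> hom C T M" "(p \<cdot> m) \<cdot> h = zero T Y"
    then have "p \<cdot> (m \<cdot> h) = zero T Y" using p m(1) by (simp add: hom_def)
    then obtain u where u: "u \<in> hom C T K" "k \<cdot> u = m \<cdot> h"
      using kex comp_in_hom[OF h(1) m(1)] by blast
    have "m \<cdot> (a \<cdot> u) = m \<cdot> h" using u(1) a(1) m(1) by (simp add: hom_def flip: u(2) a(2))
    then have "a \<cdot> u = h" by (rule mono_cancel[OF m(2,1) comp_in_hom[OF u(1) a(1)] h(1)])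
    then show "\<exists>u. u \<in> hom C T K \<and> a \<cdot> u = h" using u(1) by blast
  qed
  have eqs: "m \<cdot> a = k \<cdot> Id C K" "Id C Y \<cdot> (p \<cdot> m) = p \<cdot> m" "m \<cdot> b = s \<cdot> Id C Y"
    using a(2) b(2) pm k(1) s comp_id id_comp by metis+
  have "split_short_five_lemma C" using assms unfolding protomodular_def by blast
  then show "is_iso C m"
    unfolding split_short_five_lemma_def
    using point a(1) kernel ps k id_in_hom[OF obs(3)] m(1) id_in_hom[OF obs(2)] eqs
      iso[OF obs(3)] iso[OF obs(2)] by blast
qed

end

section \<open>The axioms\<close>

context generated_points
begin

lemma kernel_pair_is_equivalence:
  assumes "is_kernel_pair C f r\<^sub>1 r\<^sub>2"
  shows "is_equivalence_relation C r\<^sub>1 r\<^sub>2"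
proof -
  obtain X Z where f: "f \<in> hom C X Z"
    using assms unfolding is_kernel_pair_def is_pullback_def by blast
  obtain R where r: "r\<^sub>1 \<in> hom C R X" "r\<^sub>2 \<in> hom C R X"
    and ex: "\<And>T a b. \<lbrakk>a \<in> hom C T X; b \<in> hom C T X; f \<cdot> a = f \<cdot> b\<rbrakk>
       \<Longrightarrow> \<exists>h. h \<in> hom C T R \<and> r\<^sub>1 \<cdot> h = a \<and> r\<^sub>2 \<cdot> h = b"
    and uq: "\<And>T h h'. \<lbrakk>h \<in> hom C T R; h' \<in> hom C T R; r\<^sub>1 \<cdot> h = r\<^sub>1 \<cdot> h'; r\<^sub>2 \<cdot> h = r\<^sub>2 \<cdot> h'\<rbrakk> \<Longrightarrow> h = h'"
    using assms unfolding is_kernel_pair_def by (rule pullbackE[OF _ f f]) blast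
  have "relation R X X r\<^sub>1 r\<^sub>2" unfolding relation_def using r uq by blast
  moreover obtain d where "d \<in> hom C X R" "r\<^sub>1 \<cdot> d = Id C X" "r\<^sub>2 \<cdot> d = Id C X"
    using ex[OF id_in_hom id_in_hom] homD(4)[OF f] by blast
  ultimately show ?thesis by (rule reflexive_relation_is_equivalence)
qed

theorem regular_from_A3:
  assumes "axiom_A3 C" "has_coequalizers_of_equivalence_relations C"
  shows "regular C"
  unfolding regular_def
proof (intro conjI allI impI)
  show "finitely_complete C"
    by (rule finitely_complete_from_products_equalizers[OF products equalizers])
  show "is_regular_epi C p\<^sub>2" if "is_regular_epi C f \<and> is_pullback C f g p\<^sub>1 p\<^sub>2" for f g p\<^sub>1 p\<^sub>2
  proof -
    have "\<exists>X Y. f \<in> hom C X Y" using that unfolding is_pullback_def by blast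
    then have "is_cokernel C f" using that regular_epi_is_cokernel by blast
    then show ?thesis using that assms(1) cokernel_regular_epi unfolding axiom_A3_def by blast
  qed
  show "\<exists>q. is_coequalizer C r\<^sub>1 r\<^sub>2 q" if "is_kernel_pair C f r\<^sub>1 r\<^sub>2" for f r\<^sub>1 r\<^sub>2
    using kernel_pair_is_equivalence[OF that] assms(2)
    unfolding has_coequalizers_of_equivalence_relations_def by blast
qed

text \<open>
  The image of \<open>(f, 1), (g, 1) : X \<amalg> Y \<rightarrow> Y\<close> is a reflexive relation, hence an equivalence
  relation, and it has the same coequalizer as \<open>f\<close> and \<open>g\<close>.
\<close>

theorem coequalizers_from_equivalence_relations:
  assumes reg: "regular C" and "has_finite_coproducts C" "has_coequalizers_of_equivalence_relations C"
  shows "has_coequalizers C"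
  unfolding has_coequalizers_def
proof (intro allI impI, elim conjE)
  fix X Y f g assume f: "f \<in> hom C X Y" and g: "g \<in> hom C X Y"
  have Y: "Y \<in> Ob C" using homD[OF f] by blast
  obtain S \<iota>\<^sub>1 \<iota>\<^sub>2 where S: "is_binary_coproduct C X Y S \<iota>\<^sub>1 \<iota>\<^sub>2"
    using binary_coproduct_exists[OF assms(2) homD(4)[OF f] Y] .
  then have \<iota>: "\<iota>\<^sub>1 \<in> hom C X S" "\<iota>\<^sub>2 \<in> hom C Y S" unfolding is_binary_coproduct_def by blast+
  have Suq: "a = b"
    if ab: "a \<in> hom C S T" "b \<in> hom C S T" "a \<cdot> \<iota>\<^sub>1 = b \<cdot> \<iota>\<^sub>1" "a \<cdot> \<iota>\<^sub>2 = b \<cdot> \<iota>\<^sub>2" for T a b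
  proof -
    have "\<exists>!h. h \<in> hom C S T \<and> h \<cdot> \<iota>\<^sub>1 = a \<cdot> \<iota>\<^sub>1 \<and> h \<cdot> \<iota>\<^sub>2 = a \<cdot> \<iota>\<^sub>2"
      using S comp_in_hom[OF \<iota>(1) ab(1)] comp_in_hom[OF \<iota>(2) ab(1)]
      unfolding is_binary_coproduct_def by blast
    then show ?thesis using ab by metis
  qed
  obtain u where u: "u \<in> hom C S Y" "u \<cdot> \<iota>\<^sub>1 = f" "u \<cdot> \<iota>\<^sub>2 = Id C Y"
    using S f id_in_hom[OF Y] unfolding is_binary_coproduct_def by blast
  obtain v where v: "v \<in> hom C S Y" "v \<cdot> \<iota>\<^sub>1 = g" "v \<cdot> \<iota>\<^sub>2 = Id C Y"
    using S g id_in_hom[OF Y] unfolding is_binary_coproduct_def by blast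
  obtain R r\<^sub>1 r\<^sub>2 e where R: "relation R Y Y r\<^sub>1 r\<^sub>2" and e: "e \<in> hom C S R" "is_regular_epi C e"
    and re: "r\<^sub>1 \<cdot> e = u" "r\<^sub>2 \<cdot> e = v"
    using relation_image[OF reg u(1) v(1)] .
  note r = relationD[OF R]
  have "r\<^sub>1 \<cdot> (e \<cdot> \<iota>\<^sub>2) = Id C Y" "r\<^sub>2 \<cdot> (e \<cdot> \<iota>\<^sub>2) = Id C Y"
    using whisker[OF re(1)] whisker[OF re(2)] r(1,2) e(1) \<iota>(2) u(3) v(3) by (simp_all add: hom_def)
  then have "is_equivalence_relation C r\<^sub>1 r\<^sub>2"
    by (rule reflexive_relation_is_equivalence[OF R comp_in_hom[OF \<iota>(2) e(1)]])
  then obtain q where "is_coequalizer C r\<^sub>1 r\<^sub>2 q"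
    using assms(3) unfolding has_coequalizers_of_equivalence_relations_def by blast
  then obtain R' Y' Q where q': "r\<^sub>1 \<in> hom C R' Y'" "q \<in> hom C Y' Q" "q \<cdot> r\<^sub>1 = q \<cdot> r\<^sub>2"
    "\<And>T h. \<lbrakk>h \<in> hom C Y' T; h \<cdot> r\<^sub>1 = h \<cdot> r\<^sub>2\<rbrakk> \<Longrightarrow> \<exists>u. u \<in> hom C Q T \<and> u \<cdot> q = h"
    "\<And>T a b. \<lbrakk>a \<in> hom C Q T; b \<in> hom C Q T; a \<cdot> q = b \<cdot> q\<rbrakk> \<Longrightarrow> a = b"
    by (elim coequalizerE) metis
  moreover have "Y' = Y" using q'(1) r(1) by (auto simp: hom_def)
  ultimately have q: "q \<in> hom C Y Q" "q \<cdot> r\<^sub>1 = q \<cdot> r\<^sub>2" by auto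
  have qu: "q \<cdot> u = q \<cdot> v"
  proof -
    have "q \<cdot> u = (q \<cdot> r\<^sub>1) \<cdot> e" using q(1) r(1) e(1) by (simp add: hom_def flip: re)
    also have "\<dots> = q \<cdot> v" unfolding q(2) using q(1) r(2) e(1) by (simp add: hom_def flip: re)
    finally show ?thesis .
  qed
  have "is_coequalizer C f g q"
  proof (rule coequalizerI[OF f g q(1)])
    have "q \<cdot> f = (q \<cdot> u) \<cdot> \<iota>\<^sub>1" using q(1) u(1) \<iota>(1) by (simp add: hom_def flip: u(2))
    also have "\<dots> = q \<cdot> g" unfolding qu using q(1) v(1) \<iota>(1) by (simp add: hom_def flip: v(2))
    finally show "q \<cdot> f = q \<cdot> g" .
  next
    fix T a b assume "a \<in> hom C Q T" "b \<in> hom C Q T" "a \<cdot> q = b \<cdot> q"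
    then show "a = b" by (rule q'(5))
  next
    fix T h assume h: "h \<in> hom C Y T" "h \<cdot> f = h \<cdot> g"
    have "h \<cdot> u = h \<cdot> v"
    proof (rule Suq[OF comp_in_hom[OF u(1) h(1)] comp_in_hom[OF v(1) h(1)]])
      show "(h \<cdot> u) \<cdot> \<iota>\<^sub>1 = (h \<cdot> v) \<cdot> \<iota>\<^sub>1" "(h \<cdot> u) \<cdot> \<iota>\<^sub>2 = (h \<cdot> v) \<cdot> \<iota>\<^sub>2"
        using h u v \<iota> by (simp_all add: hom_def)
    qed
    then have "(h \<cdot> r\<^sub>1) \<cdot> e = (h \<cdot> r\<^sub>2) \<cdot> e" using h(1) r(1,2) e(1) re by (simp add: hom_def)
    then have "h \<cdot> r\<^sub>1 = h \<cdot> r\<^sub>2"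
      by (rule regular_epi_cancel[OF e(2,1) comp_in_hom[OF r(1) h(1)] comp_in_hom[OF r(2) h(1)]])
    then show "\<exists>u. u \<in> hom C Q T \<and> u \<cdot> q = h" using q'(4) h(1) \<open>Y' = Y\<close> by blast
  qed
  then show "\<exists>q. is_coequalizer C f g q" ..
qed

text \<open>The image of \<open>\<langle>k, s\<rangle>\<close> is a subobject containing \<open>k\<close> and \<open>s\<close>, so it is everything.\<close>

theorem A2_from_regular:
  assumes "regular C"
  shows "axiom_A2 C"
  unfolding axiom_A2_def
proof (intro allI impI, elim conjE)
  fix X Y p s K k S \<iota>\<^sub>1 \<iota>\<^sub>2 u
  assume ps: "is_split_epi C X Y p s" and k: "k \<in> hom C K X" "is_kernel_of C p k"
    and S: "is_binary_coproduct C K Y S \<iota>\<^sub>1 \<iota>\<^sub>2"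
    and u: "u \<in> hom C S X" "u \<cdot> \<iota>\<^sub>1 = k" "u \<cdot> \<iota>\<^sub>2 = s"
  have \<iota>: "\<iota>\<^sub>1 \<in> hom C K S" "\<iota>\<^sub>2 \<in> hom C Y S" using S unfolding is_binary_coproduct_def by blast+
  obtain I e m where e: "e \<in> hom C S I" "is_regular_epi C e" and m: "m \<in> hom C I X" "is_mono C m"
    and eq: "u = m \<cdot> e"
    using image_factorization[OF assms u(1)] .
  have "m \<cdot> (e \<cdot> \<iota>\<^sub>1) = k" "m \<cdot> (e \<cdot> \<iota>\<^sub>2) = s"
    using u(2,3) e(1) m(1) \<iota> unfolding eq by (simp_all add: hom_def)
  then have "is_iso C m"
    using generated[OF ps k m comp_in_hom[OF \<iota>(1) e(1)] _ comp_in_hom[OF \<iota>(2) e(1)]] by blast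
  then have "is_regular_epi C u" unfolding eq using iso_comp_regular_epi m(1) e by blast
  then show "is_cokernel C u" using regular_epi_is_cokernel u(1) by blast
qed

theorem A3_from_regular:
  assumes "regular C"
  shows "axiom_A3 C"
  unfolding axiom_A3_def
proof (intro allI impI, elim conjE)
  fix q g p\<^sub>1 p\<^sub>2 assume q: "is_cokernel C q" and pb: "is_pullback C q g p\<^sub>1 p\<^sub>2"
  have "is_regular_epi C p\<^sub>2"
    using assms cokernel_regular_epi[OF q] pb unfolding regular_def by blast
  moreover have "\<exists>P Y. p\<^sub>2 \<in> hom C P Y" using pb unfolding is_pullback_def by blast
  ultimately show "is_cokernel C p\<^sub>2" using regular_epi_is_cokernel by blast
qed

end

section \<open>Exactness and the axiom A4\<close>

context generated_points
begin

lemma is_kernelE: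
  assumes "is_kernel C k" "k \<in> hom C K X"
  obtains Z f where "f \<in> hom C X Z" "is_kernel_of C f k"
proof -
  obtain f where f: "is_kernel_of C f k" using assms(1) unfolding is_kernel_def by blast
  then obtain X' Z K' where "f \<in> hom C X' Z" "k \<in> hom C K' X'"
    unfolding is_kernel_of_def is_equalizer_def by blast
  then have "f \<in> hom C X Z" using assms(2) by (auto simp: hom_def)
  then show ?thesis using that f by blast
qed

text \<open>
  Let \<open>k\<close> be the kernel of \<open>f\<close> and let \<open>S\<close> be the image under \<open>q\<close> of the kernel pair \<open>R\<close> of \<open>f\<close>.
  It is a reflexive relation on \<open>Y\<close>, hence the kernel pair of some \<open>g\<close>, and the image \<open>m\<close> of
  \<open>q \<cdot> k\<close> is the kernel of \<open>g\<close>.  The point is that an element \<open>h\<close> killed by \<open>g\<close>, that is, a pair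
  \<open>(0, h)\<close> in \<open>S\<close>, lifts on a cover to a pair \<open>(0, x)\<close> in \<open>R\<close>, and not just to some
  \<open>(x\<^sub>0, x)\<close>: the image \<open>D\<close> of \<open>R \<rightarrow> S \<times> X\<close>, taking the first entry in the second component,
  contains \<open>((0, h), x\<^sub>0)\<close>, \<open>((0, 0), x\<^sub>0)\<close> and \<open>((0, 0), 0)\<close>, hence \<open>((0, h), 0)\<close> by
  difunctionality.
\<close>

theorem A4_from_exact:
  assumes exact: "exact C"
  shows "axiom_A4 C"
  unfolding axiom_A4_def
proof (intro allI impI, elim conjE)
  fix K X Y k q m
  assume k: "k \<in> hom C K X" and q: "q \<in> hom C X Y" and "is_kernel C k" "is_cokernel C q"
    and "is_image C (q \<cdot> k) m"
  have reg: "regular C" using exact unfolding exact_def by blast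
  have qepi: "is_regular_epi C q" using cokernel_regular_epi[OF \<open>is_cokernel C q\<close>] .
  have obs: "K \<in> Ob C" "X \<in> Ob C" "Y \<in> Ob C" using homD k q by blast+
  obtain K' I Y' e where e': "e \<in> hom C K' I" and m': "m \<in> hom C I Y'"
    and epi: "is_regular_epi C e" and mono: "is_mono C m" and qk: "q \<cdot> k = m \<cdot> e"
    using \<open>is_image C (q \<cdot> k) m\<close> unfolding is_image_def by blast
  have "K' = K" "Y' = Y"
    using comp_in_hom[OF k q] comp_in_hom[OF e' m'] unfolding qk by (auto simp: hom_def)
  then have e: "e \<in> hom C K I" and m: "m \<in> hom C I Y" using e' m' by auto
  obtain Z f where f: "f \<in> hom C X Z" and kf: "is_kernel_of C f k"
    using is_kernelE[OF \<open>is_kernel C k\<close> k] .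
  have fk: "f \<cdot> k = zero K Z"
    and kex: "\<And>T h. \<lbrakk>h \<in> hom C T X; f \<cdot> h = zero T Z\<rbrakk> \<Longrightarrow> \<exists>u. u \<in> hom C T K \<and> k \<cdot> u = h"
    using kernelE[OF kf f k] by blast+
  have Z: "Z \<in> Ob C" and I: "I \<in> Ob C" using homD f m by blast+
  obtain R r\<^sub>1 r\<^sub>2 where r: "r\<^sub>1 \<in> hom C R X" "r\<^sub>2 \<in> hom C R X" "f \<cdot> r\<^sub>1 = f \<cdot> r\<^sub>2"
    and Rex: "\<And>T a b. \<lbrakk>a \<in> hom C T X; b \<in> hom C T X; f \<cdot> a = f \<cdot> b\<rbrakk>
       \<Longrightarrow> \<exists>h. h \<in> hom C T R \<and> r\<^sub>1 \<cdot> h = a \<and> r\<^sub>2 \<cdot> h = b"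
    using kernel_pair_exists[OF f] by metis
  obtain d where d: "d \<in> hom C X R" "r\<^sub>1 \<cdot> d = Id C X" "r\<^sub>2 \<cdot> d = Id C X"
    using Rex[OF id_in_hom[OF obs(2)] id_in_hom[OF obs(2)]] by blast
  obtain S s\<^sub>1 s\<^sub>2 p where S: "relation S Y Y s\<^sub>1 s\<^sub>2" and p: "p \<in> hom C R S" "is_regular_epi C p"
    and sp: "s\<^sub>1 \<cdot> p = q \<cdot> r\<^sub>1" "s\<^sub>2 \<cdot> p = q \<cdot> r\<^sub>2"
    using relation_image[OF reg comp_in_hom[OF r(1) q] comp_in_hom[OF r(2) q]] .
  note s = relationD[OF S]
  have spa: "s\<^sub>1 \<cdot> (p \<cdot> a) = q \<cdot> (r\<^sub>1 \<cdot> a)" "s\<^sub>2 \<cdot> (p \<cdot> a) = q \<cdot> (r\<^sub>2 \<cdot> a)" if "a \<in> hom C T R" for a T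
    using that whisker[OF sp(1)] whisker[OF sp(2)] s(1,2) p(1) q r(1,2) by (simp_all add: hom_def)
  have rda: "r\<^sub>1 \<cdot> (d \<cdot> a) = a" "r\<^sub>2 \<cdot> (d \<cdot> a) = a" if "a \<in> hom C T X" for a T
    using that whisker[OF d(2)] whisker[OF d(3)] r(1,2) d(1) by (simp_all add: hom_def)
  obtain v where "v \<in> hom C Y S" "s\<^sub>1 \<cdot> v = Id C Y" "s\<^sub>2 \<cdot> v = Id C Y"
  proof (rule relation_locally[OF S id_in_hom[OF obs(3)] id_in_hom[OF obs(3)] qepi q
        comp_in_hom[OF d(1) p(1)]])
    show "s\<^sub>1 \<cdot> (p \<cdot> d) = Id C Y \<cdot> q" "s\<^sub>2 \<cdot> (p \<cdot> d) = Id C Y \<cdot> q"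
      using spa[OF d(1)] d(2,3) comp_id[OF q] id_comp[OF q] by simp_all
  qed
  then have "is_equivalence_relation C s\<^sub>1 s\<^sub>2" by (rule reflexive_relation_is_equivalence[OF S])
  then obtain g where "is_kernel_pair C g s\<^sub>1 s\<^sub>2" using exact unfolding exact_def by blast
  then obtain Y' W P where g': "g \<in> hom C Y' W" "s\<^sub>1 \<in> hom C P Y'" "g \<cdot> s\<^sub>1 = g \<cdot> s\<^sub>2"
    "\<And>T a b. \<lbrakk>a \<in> hom C T Y'; b \<in> hom C T Y'; g \<cdot> a = g \<cdot> b\<rbrakk>
       \<Longrightarrow> \<exists>!h. h \<in> hom C T P \<and> s\<^sub>1 \<cdot> h = a \<and> s\<^sub>2 \<cdot> h = b"
    unfolding is_kernel_pair_def is_pullback_def by (auto simp: hom_def)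
  have "Y' = Y" "P = S" using g'(2) s(1) by (auto simp: hom_def)
  with g' have g: "g \<in> hom C Y W" "g \<cdot> s\<^sub>1 = g \<cdot> s\<^sub>2"
    and Sex: "\<And>T a b. \<lbrakk>a \<in> hom C T Y; b \<in> hom C T Y; g \<cdot> a = g \<cdot> b\<rbrakk>
       \<Longrightarrow> \<exists>h. h \<in> hom C T S \<and> s\<^sub>1 \<cdot> h = a \<and> s\<^sub>2 \<cdot> h = b"
    by blast+
  have W: "W \<in> Ob C" using homD[OF g(1)] by blast
  obtain D d\<^sub>0 d\<^sub>1 c where D: "relation D S X d\<^sub>0 d\<^sub>1" and c: "c \<in> hom C R D" "is_regular_epi C c"
    and dc: "d\<^sub>0 \<cdot> c = p" "d\<^sub>1 \<cdot> c = r\<^sub>1"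
    using relation_image[OF reg p(1) r(1)] .
  note d' = relationD[OF D]
  have dca: "d\<^sub>0 \<cdot> (c \<cdot> a) = p \<cdot> a" "d\<^sub>1 \<cdot> (c \<cdot> a) = r\<^sub>1 \<cdot> a" if "a \<in> hom C T R" for a T
    using that whisker[OF dc(1)] whisker[OF dc(2)] d'(1,2) c(1) by (simp_all add: hom_def)
  have DS: "D \<in> Ob C" "S \<in> Ob C" using homD d'(1) by blast+
  have "is_kernel_of C g m"
  proof (rule kernelI[OF g(1) m mono])
    have "zero K X \<in> hom C K X" using zero_arrow_zero obs by blast
    moreover have "f \<cdot> zero K X = f \<cdot> k" using f fk obs by (simp add: hom_def)
    ultimately obtain k' where k': "k' \<in> hom C K R" "r\<^sub>1 \<cdot> k' = zero K X" "r\<^sub>2 \<cdot> k' = k"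
      using Rex k by blast
    have pk': "p \<cdot> k' \<in> hom C K S" using comp_in_hom[OF k'(1) p(1)] .
    have "(g \<cdot> m) \<cdot> e = g \<cdot> (q \<cdot> k)" unfolding qk using g(1) m e by (simp add: hom_def)
    also have "\<dots> = (g \<cdot> s\<^sub>2) \<cdot> (p \<cdot> k')"
      unfolding k'(3)[symmetric] spa(2)[OF k'(1), symmetric]
      using pk' g(1) s(2) by (simp add: hom_def)
    also have "\<dots> = g \<cdot> (s\<^sub>1 \<cdot> (p \<cdot> k'))"
      unfolding g(2)[symmetric] using pk' g(1) s(1) by (simp add: hom_def)
    also have "\<dots> = zero K W"
      unfolding spa(1)[OF k'(1)] k'(2) using g(1) q obs by (simp add: hom_def)
    also have "\<dots> = zero I W \<cdot> e" using e W by (simp add: hom_def)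
    finally show "g \<cdot> m = zero I W"
      by (rule regular_epi_cancel[OF epi e comp_in_hom[OF m g(1)] zero_arrow_zero(2)[OF I W]])
  next
    fix T h assume h: "h \<in> hom C T Y" "g \<cdot> h = zero T W"
    have T: "T \<in> Ob C" using homD[OF h(1)] by blast
    have "zero T Y \<in> hom C T Y" using zero_arrow_zero obs T by blast
    moreover have "g \<cdot> zero T Y = g \<cdot> h" using g(1) h(2) T by (simp add: hom_def)
    ultimately obtain v where v: "v \<in> hom C T S" "s\<^sub>1 \<cdot> v = zero T Y" "s\<^sub>2 \<cdot> v = h"
      using Sex h(1) by blast
    obtain T\<^sub>1 t\<^sub>1 b where t1: "t\<^sub>1 \<in> hom C T\<^sub>1 T" "is_regular_epi C t\<^sub>1"
      and b: "b \<in> hom C T\<^sub>1 R" "p \<cdot> b = v \<cdot> t\<^sub>1"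
      using cover[OF reg p(2,1) v(1)] .
    have T1: "T\<^sub>1 \<in> Ob C" using homD[OF t1(1)] by blast
    have rb: "r\<^sub>1 \<cdot> b \<in> hom C T\<^sub>1 X" using comp_in_hom[OF b(1) r(1)] .
    have drb: "d \<cdot> (r\<^sub>1 \<cdot> b) \<in> hom C T\<^sub>1 R" using comp_in_hom[OF rb d(1)] .
    have "q \<cdot> (r\<^sub>1 \<cdot> b) = s\<^sub>1 \<cdot> (v \<cdot> t\<^sub>1)" using spa(1)[OF b(1)] b(2) by simp
    also have "\<dots> = zero T\<^sub>1 Y"
      using whisker[OF v(2)] v(1) s(1) t1(1) obs T by (simp add: hom_def)
    finally have qrb: "q \<cdot> (r\<^sub>1 \<cdot> b) = zero T\<^sub>1 Y" .
    have pdrb: "p \<cdot> (d \<cdot> (r\<^sub>1 \<cdot> b)) = zero T\<^sub>1 S"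
    proof (rule s(3)[OF comp_in_hom[OF drb p(1)] zero_arrow_zero(2)[OF T1 DS(2)]])
      show "s\<^sub>1 \<cdot> (p \<cdot> (d \<cdot> (r\<^sub>1 \<cdot> b))) = s\<^sub>1 \<cdot> zero T\<^sub>1 S"
        "s\<^sub>2 \<cdot> (p \<cdot> (d \<cdot> (r\<^sub>1 \<cdot> b))) = s\<^sub>2 \<cdot> zero T\<^sub>1 S"
        unfolding spa[OF drb] rda[OF rb] qrb using s(1,2) T1 by (simp_all add: hom_def)
    qed
    obtain \<delta> where \<delta>: "\<delta> \<in> hom C T\<^sub>1 D" "d\<^sub>0 \<cdot> \<delta> = v \<cdot> t\<^sub>1" "d\<^sub>1 \<cdot> \<delta> = zero T\<^sub>1 X"
    proof (rule difunctional[OF D comp_in_hom[OF b(1) c(1)] comp_in_hom[OF drb c(1)]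
          zero_arrow_zero(2)[OF T1 DS(1)]])
      show "d\<^sub>1 \<cdot> (c \<cdot> b) = d\<^sub>1 \<cdot> (c \<cdot> (d \<cdot> (r\<^sub>1 \<cdot> b)))"
        unfolding dca[OF b(1)] dca[OF drb] rda[OF rb] ..
      show "d\<^sub>0 \<cdot> (c \<cdot> (d \<cdot> (r\<^sub>1 \<cdot> b))) = d\<^sub>0 \<cdot> zero T\<^sub>1 D"
        unfolding dca[OF drb] pdrb using d'(1) T1 by (simp add: hom_def)
    next
      fix \<delta>
      assume "\<delta> \<in> hom C T\<^sub>1 D" "d\<^sub>0 \<cdot> \<delta> = d\<^sub>0 \<cdot> (c \<cdot> b)" "d\<^sub>1 \<cdot> \<delta> = d\<^sub>1 \<cdot> zero T\<^sub>1 D"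
      moreover have "d\<^sub>1 \<cdot> zero T\<^sub>1 D = zero T\<^sub>1 X" using d'(2) T1 by (simp add: hom_def)
      ultimately show ?thesis using that dca(1)[OF b(1)] b(2) by metis
    qed
    obtain T\<^sub>2 t\<^sub>2 a where t2: "t\<^sub>2 \<in> hom C T\<^sub>2 T\<^sub>1" "is_regular_epi C t\<^sub>2"
      and a: "a \<in> hom C T\<^sub>2 R" "c \<cdot> a = \<delta> \<cdot> t\<^sub>2"
      using cover[OF reg c(2,1) \<delta>(1)] .
    have T2: "T\<^sub>2 \<in> Ob C" using homD[OF t2(1)] by blast
    have "r\<^sub>1 \<cdot> a = d\<^sub>1 \<cdot> (\<delta> \<cdot> t\<^sub>2)" using dca(2)[OF a(1)] a(2) by simp
    also have "\<dots> = zero T\<^sub>2 X"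
      using whisker[OF \<delta>(3)] \<delta>(1) d'(2) t2(1) obs T1 by (simp add: hom_def)
    finally have r1a: "r\<^sub>1 \<cdot> a = zero T\<^sub>2 X" .
    have "f \<cdot> (r\<^sub>2 \<cdot> a) = f \<cdot> (r\<^sub>1 \<cdot> a)" using whisker[OF r(3)] f r(1,2) a(1) by (simp add: hom_def)
    also have "\<dots> = zero T\<^sub>2 Z" unfolding r1a using f T2 by (simp add: hom_def)
    finally obtain x where x: "x \<in> hom C T\<^sub>2 K" "k \<cdot> x = r\<^sub>2 \<cdot> a"
      using kex comp_in_hom[OF a(1) r(2)] by blast
    have ht: "h \<cdot> t\<^sub>1 \<in> hom C T\<^sub>1 Y" using comp_in_hom[OF t1(1) h(1)] .
    have "(h \<cdot> t\<^sub>1) \<cdot> t\<^sub>2 = s\<^sub>2 \<cdot> ((v \<cdot> t\<^sub>1) \<cdot> t\<^sub>2)"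
      using whisker[OF v(3)] v(1) s(2) t1(1) t2(1) h(1) by (simp add: hom_def)
    also have "(v \<cdot> t\<^sub>1) \<cdot> t\<^sub>2 = d\<^sub>0 \<cdot> (c \<cdot> a)"
      unfolding a(2) \<delta>(2)[symmetric] using \<delta>(1) d'(1) t2(1) by (simp add: hom_def)
    also have "s\<^sub>2 \<cdot> (d\<^sub>0 \<cdot> (c \<cdot> a)) = q \<cdot> (k \<cdot> x)"
      unfolding dca[OF a(1)] spa[OF a(1)] x(2) ..
    also have "\<dots> = m \<cdot> (e \<cdot> x)" using whisker[OF qk] q k m e x(1) by (simp add: hom_def)
    finally obtain w where w: "w \<in> hom C T\<^sub>1 I" "m \<cdot> w = h \<cdot> t\<^sub>1"
      using factor_through_mono_locally[OF t2(2,1) mono m ht comp_in_hom[OF x(1) e]] by blast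
    then show "\<exists>u. u \<in> hom C T I \<and> m \<cdot> u = h"
      using factor_through_mono_locally[OF t1(2,1) mono m h(1) w(1)] by metis
  qed
  then show "is_kernel C m" unfolding is_kernel_def by blast
qed

text \<open>
  If \<open>k\<close> is the kernel of \<open>r\<^sub>1\<close>, then \<open>r\<^sub>2 \<cdot> k\<close> is its own image by the split epimorphism \<open>r\<^sub>2\<close>, so A4
  makes it the kernel of some \<open>f\<close>.  Then \<open>R\<close> lies in the kernel pair of \<open>f\<close>, and it
  contains its diagonal and the kernel of its first projection; so it is all of it.
\<close>

theorem exact_from_A4:
  assumes reg: "regular C" and A4: "axiom_A4 C"
  shows "exact C"
  unfolding exact_def
proof (intro conjI allI impI reg)
  fix r\<^sub>1 r\<^sub>2 assume "is_equivalence_relation C r\<^sub>1 r\<^sub>2"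
  then obtain R X d where r: "r\<^sub>1 \<in> hom C R X" "r\<^sub>2 \<in> hom C R X"
    and ruq: "\<And>T a b. \<lbrakk>a \<in> hom C T R; b \<in> hom C T R; r\<^sub>1 \<cdot> a = r\<^sub>1 \<cdot> b; r\<^sub>2 \<cdot> a = r\<^sub>2 \<cdot> b\<rbrakk> \<Longrightarrow> a = b"
    and d: "d \<in> hom C X R" "r\<^sub>1 \<cdot> d = Id C X" "r\<^sub>2 \<cdot> d = Id C X"
    unfolding is_equivalence_relation_def by blast
  have X: "X \<in> Ob C" using homD[OF d(1)] by blast
  obtain K k where k: "k \<in> hom C K R" "is_kernel_of C r\<^sub>1 k" using kernel_exists[OF r(1)] .
  have K: "K \<in> Ob C" using homD[OF k(1)] by blast
  have kmono: "is_mono C k" and r1k: "r\<^sub>1 \<cdot> k = zero K X" using kernelE[OF k(2) r(1) k(1)] by blast+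
  have n: "r\<^sub>2 \<cdot> k \<in> hom C K X" using comp_in_hom[OF k(1) r(2)] .
  have r1ka: "r\<^sub>1 \<cdot> (k \<cdot> a) = zero T X" if "a \<in> hom C T K" for a T
    using that whisker[OF r1k] r(1) k(1) X by (simp add: hom_def)
  have nmono: "is_mono C (r\<^sub>2 \<cdot> k)"
  proof (rule is_monoI[OF n])
    fix T a b assume ab: "a \<in> hom C T K" "b \<in> hom C T K" "(r\<^sub>2 \<cdot> k) \<cdot> a = (r\<^sub>2 \<cdot> k) \<cdot> b"
    then have "r\<^sub>2 \<cdot> (k \<cdot> a) = r\<^sub>2 \<cdot> (k \<cdot> b)" using r(2) k(1) by (simp add: hom_def)
    then have "k \<cdot> a = k \<cdot> b"
      using ruq comp_in_hom[OF ab(1) k(1)] comp_in_hom[OF ab(2) k(1)] r1ka ab(1,2) by metis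
    then show "a = b" by (rule mono_cancel[OF kmono k(1) ab(1,2)])
  qed
  have "is_split_epi C R X r\<^sub>2 d" using r(2) d unfolding is_split_epi_def by blast
  then have "is_cokernel C r\<^sub>2" using regular_epi_is_cokernel split_epi_regular r(2) by blast
  moreover have "is_kernel C k" using k(2) unfolding is_kernel_def by blast
  moreover have "is_image C (r\<^sub>2 \<cdot> k) (r\<^sub>2 \<cdot> k)"
    using id_in_hom[OF K] n id_regular_epi[OF K] nmono comp_id[OF n] unfolding is_image_def by metis
  ultimately have "is_kernel C (r\<^sub>2 \<cdot> k)" using A4 k(1) r(2) unfolding axiom_A4_def by blast
  then obtain Z f where f: "f \<in> hom C X Z" and nf: "is_kernel_of C f (r\<^sub>2 \<cdot> k)"
    using is_kernelE n by blast
  have fn: "f \<cdot> (r\<^sub>2 \<cdot> k) = zero K Z"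
    and nex: "\<And>T h. \<lbrakk>h \<in> hom C T X; f \<cdot> h = zero T Z\<rbrakk> \<Longrightarrow> \<exists>u. u \<in> hom C T K \<and> (r\<^sub>2 \<cdot> k) \<cdot> u = h"
    using kernelE[OF nf f n] by blast+
  have fr: "f \<cdot> r\<^sub>1 = f \<cdot> r\<^sub>2" by (rule coequalizes_reflexive_graph[OF r d k f fn])
  obtain S s\<^sub>1 s\<^sub>2 where s: "s\<^sub>1 \<in> hom C S X" "s\<^sub>2 \<in> hom C S X" "f \<cdot> s\<^sub>1 = f \<cdot> s\<^sub>2"
    and Sex: "\<And>T a b. \<lbrakk>a \<in> hom C T X; b \<in> hom C T X; f \<cdot> a = f \<cdot> b\<rbrakk>
       \<Longrightarrow> \<exists>h. h \<in> hom C T S \<and> s\<^sub>1 \<cdot> h = a \<and> s\<^sub>2 \<cdot> h = b"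
    and Suq: "\<And>T h h'. \<lbrakk>h \<in> hom C T S; h' \<in> hom C T S; s\<^sub>1 \<cdot> h = s\<^sub>1 \<cdot> h'; s\<^sub>2 \<cdot> h = s\<^sub>2 \<cdot> h'\<rbrakk> \<Longrightarrow> h = h'"
    using kernel_pair_exists[OF f] by metis
  obtain j where j: "j \<in> hom C R S" "s\<^sub>1 \<cdot> j = r\<^sub>1" "s\<^sub>2 \<cdot> j = r\<^sub>2" using Sex[OF r fr] by blast
  have sj: "s\<^sub>1 \<cdot> (j \<cdot> a) = r\<^sub>1 \<cdot> a" "s\<^sub>2 \<cdot> (j \<cdot> a) = r\<^sub>2 \<cdot> a" if "a \<in> hom C T R" for a T
    using that whisker[OF j(2)] whisker[OF j(3)] s(1,2) j(1) by (simp_all add: hom_def)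
  have jmono: "is_mono C j"
  proof (rule is_monoI[OF j(1)])
    fix T a b assume "a \<in> hom C T R" "b \<in> hom C T R" "j \<cdot> a = j \<cdot> b"
    then show "a = b" using ruq sj by metis
  qed
  have jd: "j \<cdot> d \<in> hom C X S" using comp_in_hom[OF d(1) j(1)] .
  have "s\<^sub>1 \<cdot> (j \<cdot> d) = Id C X" using sj(1)[OF d(1)] d(2) by simp
  then have split: "is_split_epi C S X s\<^sub>1 (j \<cdot> d)" using s(1) jd unfolding is_split_epi_def by blast
  obtain L \<kappa> where \<kappa>: "\<kappa> \<in> hom C L S" "is_kernel_of C s\<^sub>1 \<kappa>" using kernel_exists[OF s(1)] .
  have L: "L \<in> Ob C" using homD[OF \<kappa>(1)] by blast
  have s1\<kappa>: "s\<^sub>1 \<cdot> \<kappa> = zero L X" using kernelE[OF \<kappa>(2) s(1) \<kappa>(1)] by blast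
  have "f \<cdot> (s\<^sub>2 \<cdot> \<kappa>) = f \<cdot> (s\<^sub>1 \<cdot> \<kappa>)" using whisker[OF s(3)] f s(1,2) \<kappa>(1) by (simp add: hom_def)
  also have "\<dots> = zero L Z" unfolding s1\<kappa> using f L by (simp add: hom_def)
  finally obtain a where a: "a \<in> hom C L K" "(r\<^sub>2 \<cdot> k) \<cdot> a = s\<^sub>2 \<cdot> \<kappa>"
    using nex comp_in_hom[OF \<kappa>(1) s(2)] by blast
  have ka: "k \<cdot> a \<in> hom C L R" using comp_in_hom[OF a(1) k(1)] .
  have "j \<cdot> (k \<cdot> a) = \<kappa>"
  proof (rule Suq[OF comp_in_hom[OF ka j(1)] \<kappa>(1)])
    show "s\<^sub>1 \<cdot> (j \<cdot> (k \<cdot> a)) = s\<^sub>1 \<cdot> \<kappa>" unfolding sj[OF ka] r1ka[OF a(1)] s1\<kappa> ..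
    show "s\<^sub>2 \<cdot> (j \<cdot> (k \<cdot> a)) = s\<^sub>2 \<cdot> \<kappa>"
      unfolding sj[OF ka] a(2)[symmetric] using a(1) k(1) r(2) by (simp add: hom_def)
  qed
  then obtain c where c: "c \<in> hom C S R" "j \<cdot> c = Id C S"
    using generated_section[OF split \<kappa> j(1) jmono ka _ d(1)] by blast
  have rc: "r\<^sub>1 \<cdot> (c \<cdot> h) = s\<^sub>1 \<cdot> h" "r\<^sub>2 \<cdot> (c \<cdot> h) = s\<^sub>2 \<cdot> h" if h: "h \<in> hom C T S" for h T
  proof -
    have "j \<cdot> (c \<cdot> h) = h" using whisker[OF c(2)] c(1) j(1) h by (simp add: hom_def)
    then show "r\<^sub>1 \<cdot> (c \<cdot> h) = s\<^sub>1 \<cdot> h" "r\<^sub>2 \<cdot> (c \<cdot> h) = s\<^sub>2 \<cdot> h"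
      using sj[OF comp_in_hom[OF h c(1)]] by simp_all
  qed
  have "is_pullback C f f r\<^sub>1 r\<^sub>2"
  proof (rule pullbackI[OF f f r fr ruq])
    fix T a b assume "a \<in> hom C T X" "b \<in> hom C T X" "f \<cdot> a = f \<cdot> b"
    then obtain h where h: "h \<in> hom C T S" "s\<^sub>1 \<cdot> h = a" "s\<^sub>2 \<cdot> h = b" using Sex by blast
    then show "\<exists>h. h \<in> hom C T R \<and> r\<^sub>1 \<cdot> h = a \<and> r\<^sub>2 \<cdot> h = b"
      using rc[OF h(1)] comp_in_hom[OF h(1) c(1)] by metis
  qed
  then show "\<exists>f. is_kernel_pair C f r\<^sub>1 r\<^sub>2" unfolding is_kernel_pair_def by blast
qed

end

section \<open>The two characterizations\<close>

context category
begin

lemma homological_from_axioms: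
  assumes "axiom_A1' C" "axiom_A2 C" "axiom_A3 C"
  shows "generated_points C" "homological C" "has_coequalizers C" "finitely_cocomplete C"
proof -
  interpret pointed_lex C
    by unfold_locales (use assms(1) in \<open>simp_all add: axiom_A1'_def\<close>)
  have coprod: "has_finite_coproducts C" and coeq: "has_coequalizers_of_equivalence_relations C"
    using assms(1) unfolding axiom_A1'_def by blast+
  show gen: "generated_points C" by (rule generated_points_from_A2[OF coprod assms(2)])
  interpret generated_points C by (rule gen)
  have reg: "regular C" by (rule regular_from_A3[OF assms(3) coeq])
  then show "homological C" using pointed protomodular unfolding homological_def by blast
  show "has_coequalizers C" by (rule coequalizers_from_equivalence_relations[OF reg coprod coeq])
  then show "finitely_cocomplete C" using coprod finitely_cocomplete_iff by blast
qed

lemma generated_points_from_homological: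
  assumes "homological C"
  shows "generated_points C"
proof -
  have C: "pointed C" "regular C" "protomodular C" using assms unfolding homological_def by blast+
  interpret pointed_lex C
    by unfold_locales (use C finitely_complete_iff in \<open>auto simp: regular_def\<close>)
  show ?thesis by (rule generated_points_from_protomodular[OF C(3)])
qed

lemma axioms_from_homological:
  assumes "homological C" "has_finite_coproducts C" "has_coequalizers C"
  shows "axiom_A1 C" "axiom_A2 C" "axiom_A3 C"
proof -
  interpret generated_points C by (rule generated_points_from_homological[OF assms(1)])
  have "regular C" using assms(1) unfolding homological_def by blast
  then show "axiom_A2 C" "axiom_A3 C" using A2_from_regular A3_from_regular by blast+
  show "axiom_A1 C"
    using pointed products equalizers assms(2,3) unfolding axiom_A1_def by blast
qed

lemma A1'_from_A1: "axiom_A1 C \<Longrightarrow> axiom_A1' C"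
  unfolding axiom_A1_def axiom_A1'_def has_coequalizers_def
    has_coequalizers_of_equivalence_relations_def is_equivalence_relation_def by blast

lemma homological_characterization:
  "finitely_cocomplete C \<and> homological C \<longleftrightarrow> axiom_A1 C \<and> axiom_A2 C \<and> axiom_A3 C"
  "finitely_cocomplete C \<and> homological C \<longleftrightarrow> axiom_A1' C \<and> axiom_A2 C \<and> axiom_A3 C"
  using homological_from_axioms axioms_from_homological A1'_from_A1 finitely_cocomplete_iff by blast+

lemma semi_abelian_from_axioms:
  assumes "axiom_A1' C" "axiom_A2 C" "axiom_A3 C" "axiom_A4 C"
  shows "semi_abelian C"
proof -
  interpret generated_points C by (rule homological_from_axioms[OF assms(1-3)])
  have "regular C" using homological_from_axioms[OF assms(1-3)] unfolding homological_def by blast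
  then have "exact C" using exact_from_A4 assms(4) by blast
  then show ?thesis
    using pointed protomodular assms(1) unfolding semi_abelian_def axiom_A1'_def by blast
qed

lemma axioms_from_semi_abelian:
  assumes "semi_abelian C"
  shows "axiom_A1 C" "axiom_A2 C" "axiom_A3 C" "axiom_A4 C"
proof -
  have C: "exact C" "has_finite_coproducts C" using assms unfolding semi_abelian_def by blast+
  then have reg: "regular C" unfolding exact_def by blast
  then have hom: "homological C" using assms unfolding semi_abelian_def homological_def by blast
  interpret generated_points C by (rule generated_points_from_homological[OF hom])
  have "has_coequalizers_of_equivalence_relations C"
    using C(1) unfolding exact_def regular_def has_coequalizers_of_equivalence_relations_def by blast
  then have "has_coequalizers C" by (rule coequalizers_from_equivalence_relations[OF reg C(2)])
  then show "axiom_A1 C" "axiom_A2 C" "axiom_A3 C" using axioms_from_homological hom C(2) by blast+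
  show "axiom_A4 C" by (rule A4_from_exact[OF C(1)])
qed

end

theorem theorem6:
  fixes C :: "('o, 'a) precat"
  assumes "category C"
  shows
    "(finitely_cocomplete C \<and> homological C \<longleftrightarrow> axiom_A1 C \<and> axiom_A2 C \<and> axiom_A3 C) \<and>
     (semi_abelian C \<longleftrightarrow> axiom_A1 C \<and> axiom_A2 C \<and> axiom_A3 C \<and> axiom_A4 C) \<and>
     (finitely_cocomplete C \<and> homological C \<longleftrightarrow> axiom_A1' C \<and> axiom_A2 C \<and> axiom_A3 C) \<and>
     (semi_abelian C \<longleftrightarrow> axiom_A1' C \<and> axiom_A2 C \<and> axiom_A3 C \<and> axiom_A4 C)"
proof -
  interpret category C by (rule assms)
  show ?thesis
    using homological_characterization semi_abelian_from_axioms axioms_from_semi_abelian A1'_from_A1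
    by blast
qed

end
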